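(* Let $\lambda$, $m$, $n$, $k$ and $c_1,\dots,c_k$ be positive integers such that there exists a $(c_1,c_2,\ldots,c_k)$-cycle decomposition of $\lambda m K_n$. Then the complete equipartite multigraph $\lambda K_{n\times m}$ admits a $(c_1m,c_2m,\ldots,c_km)$-cycle decomposition.
   Context: All graphs are finite, loopless and undirected, possibly with multiple (parallel) edges. $K_n$ is the complete graph on $n$ vertices, and $K_{n\times m}$ is the complete $n$-partite graph with all $n$ parts of cardinality $m$. For a simple graph $\mathcal G$ and a positive integer $\mu$, $\mu\mathcal G$ denotes the multigraph with underlying simple graph $\mathcal G$ in which every edge has multiplicity $\mu$; thus $\lambda m K_n$ is $K_n$ with every edge of multiplicity $\lambda m$. A cycle of length $c\ge 2$ is a connected 2-regular graph with $c$ edges (a cycle of length 2 consists of two distinct parallel edges between two vertices). A 1-factor of a graph is a spanning 1-regular subgraph. A decomposition of a graph $\mathcal G$ is a collection of subgraphs of $\mathcal G$ whose edge sets partition the edge set of $\mathcal G$. A $(c_1,\ldots,c_k)$-cycle decomposition of $\mathcal G$ is a decomposition of $\mathcal G$ into $k$ cycles of lengths $c_1,\dots,c_k$, respectively, if every vertex of $\mathcal G$ has even degree, and a decomposition of $\mathcal G$ into $k$ cycles of lengths $c_1,\dots,c_k$ plus a 1-factor if every vertex of $\mathcal G$ has odd degree. *)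

theory Defs
  imports Main
begin

text \<open>
  Edges are objects in their own right, so that distinct parallel edges are distinguished;
  \<open>ends e\<close> is the set of the two endpoints of the edge \<open>e\<close>.  The function \<open>ends\<close>
  is only meaningful on \<open>edges\<close>.
\<close>

record ('v, 'e) multigraph =
  verts :: "'v set"
  edges :: "'e set"
  ends :: "'e \<Rightarrow> 'v set"

definition wf_multigraph :: "('v, 'e) multigraph \<Rightarrow> bool" where
  "wf_multigraph G \<longleftrightarrow>
     finite (verts G) \<and> finite (edges G) \<and>
     (\<forall>e\<in>edges G. ends G e \<subseteq> verts G \<and> card (ends G e) = 2)"

definition mg_degree :: "('v, 'e) multigraph \<Rightarrow> 'v \<Rightarrow> nat" where
  "mg_degree G v = card {e \<in> edges G. v \<in> ends G e}"

definition regular_multigraph :: "nat \<Rightarrow> ('v, 'e) multigraph \<Rightarrow> bool" where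
  "regular_multigraph r G \<longleftrightarrow> (\<forall>v\<in>verts G. mg_degree G v = r)"

definition adjacency :: "('v, 'e) multigraph \<Rightarrow> ('v \<times> 'v) set" where
  "adjacency G = {(u, v). \<exists>e\<in>edges G. ends G e = {u, v}}"

definition connected_multigraph :: "('v, 'e) multigraph \<Rightarrow> bool" where
  "connected_multigraph G \<longleftrightarrow>
     verts G \<noteq> {} \<and> (\<forall>u\<in>verts G. \<forall>v\<in>verts G. (u, v) \<in> (adjacency G)\<^sup>*)"

definition sub_multigraph :: "('v, 'e) multigraph \<Rightarrow> ('v, 'e) multigraph \<Rightarrow> bool" where
  "sub_multigraph H G \<longleftrightarrow>
     wf_multigraph H \<and> verts H \<subseteq> verts G \<and> edges H \<subseteq> edges G \<and>
     (\<forall>e\<in>edges H. ends H e = ends G e)"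

definition cycle_of_length :: "nat \<Rightarrow> ('v, 'e) multigraph \<Rightarrow> bool" where
  "cycle_of_length c H \<longleftrightarrow>
     c \<ge> 2 \<and> wf_multigraph H \<and> connected_multigraph H \<and> regular_multigraph 2 H \<and>
     card (edges H) = c"

definition one_factor :: "('v, 'e) multigraph \<Rightarrow> ('v, 'e) multigraph \<Rightarrow> bool" where
  "one_factor F G \<longleftrightarrow>
     sub_multigraph F G \<and> verts F = verts G \<and> regular_multigraph 1 F"

definition decomposition :: "('v, 'e) multigraph list \<Rightarrow> ('v, 'e) multigraph \<Rightarrow> bool" where
  "decomposition Hs G \<longleftrightarrow>
     (\<forall>H\<in>set Hs. sub_multigraph H G) \<and>
     (\<forall>e\<in>edges G. \<exists>!i. i < length Hs \<and> e \<in> edges (Hs ! i))"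

text \<open>
  The list \<open>cs\<close> holds the cycle lengths.  A graph having both vertices of even and vertices
  of odd degree has no cycle decomposition in this sense.
\<close>

definition cycle_decomposition :: "nat list \<Rightarrow> ('v, 'e) multigraph \<Rightarrow> bool" where
  "cycle_decomposition cs G \<longleftrightarrow>
     (\<forall>v\<in>verts G. even (mg_degree G v)) \<and>
       (\<exists>Hs. list_all2 cycle_of_length cs Hs \<and> decomposition Hs G)
     \<or>
     (\<forall>v\<in>verts G. odd (mg_degree G v)) \<and>
       (\<exists>Hs F. list_all2 cycle_of_length cs Hs \<and> one_factor F G \<and> decomposition (F # Hs) G)"

text \<open>In a simple graph an edge is identified with the set of its two endpoints.\<close>

definition complete_graph :: "nat \<Rightarrow> (nat, nat set) multigraph" where
  "complete_graph n =
     \<lparr>verts = {..<n}, edges = {{u, v} | u v. u < n \<and> v < n \<and> u \<noteq> v}, ends = (\<lambda>e. e)\<rparr>"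

text \<open>The first component of a vertex is the index of its part.\<close>

definition complete_equipartite :: "nat \<Rightarrow> nat \<Rightarrow> (nat \<times> nat, (nat \<times> nat) set) multigraph" where
  "complete_equipartite n m =
     \<lparr>verts = {..<n} \<times> {..<m},
      edges = {{u, v} | u v. u \<in> {..<n} \<times> {..<m} \<and> v \<in> {..<n} \<times> {..<m} \<and> fst u \<noteq> fst v},
      ends = (\<lambda>e. e)\<rparr>"

definition edge_multiple :: "nat \<Rightarrow> ('v, 'e) multigraph \<Rightarrow> ('v, 'e \<times> nat) multigraph" where
  "edge_multiple \<mu> G =
     \<lparr>verts = verts G, edges = edges G \<times> {..<\<mu>}, ends = (\<lambda>e. ends G (fst e))\<rparr>"

lemma wf_complete_graph: "wf_multigraph (complete_graph n)"
proof -
  have "{{u, v} | u v. u < n \<and> v < n \<and> u \<noteq> v} \<subseteq> Pow {..<n}" by auto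
  then have "finite {{u, v} | u v. u < n \<and> v < n \<and> u \<noteq> v}"
    by (rule finite_subset) simp
  then show ?thesis
    by (auto simp: wf_multigraph_def complete_graph_def card_insert_if)
qed

lemma wf_complete_equipartite: "wf_multigraph (complete_equipartite n m)"
proof -
  let ?V = "{..<n} \<times> {..<m}"
  let ?E = "{{u, v} | u v. u \<in> ?V \<and> v \<in> ?V \<and> fst u \<noteq> fst v}"
  have "?E \<subseteq> Pow ?V" by auto
  then have fin: "finite ?E" by (rule finite_subset) simp
  have "e \<subseteq> ?V \<and> card e = 2" if "e \<in> ?E" for e
  proof -
    from that obtain u v where "e = {u, v}" "u \<in> ?V" "v \<in> ?V" "fst u \<noteq> fst v" by blast
    moreover from this have "u \<noteq> v" by blast
    ultimately show ?thesis by simp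
  qed
  with fin show ?thesis
    unfolding wf_multigraph_def complete_equipartite_def by simp
qed

lemma wf_edge_multiple: "wf_multigraph G \<Longrightarrow> wf_multigraph (edge_multiple \<mu> G)"
  by (auto simp: wf_multigraph_def edge_multiple_def)

end

theory Submission imports Defs begin

text \<open>
  The equipartite multigraph arises from the complete multigraph by taking every edge \<open>m\<close> times and
  then splitting each vertex into \<open>m\<close> vertices (a detachment). Apply this to a graph whose edges
  are coloured by the pieces of the given decomposition. Before the splitting, a piece that was a
  \<open>c\<close>-cycle is a connected graph with \<open>c * m\<close> edges and all degrees \<open>2 * m\<close>. If the splitting
  gives every new vertex an equal share of each colour, the piece becomes 2-regular, and if it
  moreover stays connected, it becomes a cycle of length \<open>c * m\<close>. In the same way a 1-factor becomes
  a 1-factor. If the splitting also shares the parallel edges between any two vertices equally, the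
  \<open>lam * m * m\<close> edges between two old vertices become \<open>lam\<close> edges between any two new vertices, which
  is the required graph.

  A splitting that is fair in all these respects is built by splitting off one vertex at a time.
  When a vertex \<open>x\<close> that stands for \<open>k\<close> final vertices gives up one of them, the edges to be moved
  are one colour class of an equitable \<open>k\<close>-colouring of the edges at \<open>x\<close>, balanced on three kinds of
  sets: the pieces, the components of each piece without \<open>x\<close>, and the bundles of parallel edges.
  If a connected even piece meets \<open>x\<close>, each of these components has an even positive number of edges
  at \<open>x\<close>, hence at least two, and balance prevents all of them from moving; so the piece stays
  connected (\<open>edge_connected_move_end\<close>, \<open>split_vertex\<close>).

  Equitable colourings exist because the first two kinds of sets are nested: one matching pairs up
  the elements of each of these sets, up to at most one, a second matching does so for the bundles,
  and the union of two matchings is bipartite, which gives an even split into two colours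
  (\<open>fibres_halved\<close>). A colouring with the least sum of squares then balances any number of colours
  (\<open>equitable_colouring\<close>).
\<close>

section \<open>Equitable colourings\<close>

text \<open>
  The union of two matchings is bipartite, since its cycles alternate between the matchings and so
  have even length. A matching is an involution here, its fixed points being the uncovered elements.
  The induction deletes an edge \<open>{x, y}\<close> of one matching and joins the two partners of \<open>x\<close> and
  \<open>y\<close> in the other matching by a new edge: a proper colouring of the smaller graph separates these
  partners, and therefore extends to \<open>x\<close> and \<open>y\<close> with different colours.
\<close>

lemma two_matchings_bipartite:
  fixes X :: "'a set"
  assumes "finite X"
    and "\<And>x. x \<in> X \<Longrightarrow> p x \<in> X \<and> p (p x) = x"
    and "\<And>x. x \<in> X \<Longrightarrow> q x \<in> X \<and> q (q x) = x"
  shows "\<exists>T. \<forall>x\<in>X. (p x \<noteq> x \<longrightarrow> (p x \<in> T \<longleftrightarrow> x \<notin> T)) \<and> (q x \<noteq> x \<longrightarrow> (q x \<in> T \<longleftrightarrow> x \<notin> T))"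
  using assms
proof (induction "card X" arbitrary: X p q rule: less_induct)
  case less
  \<comment> \<open>The reduction is stated for matchings \<open>r\<close>, \<open>s\<close> so that it serves for the pairs
    \<open>(p, q)\<close> and \<open>(q, p)\<close>.\<close>
  have step: "\<exists>T. \<forall>x\<in>X. (r x \<noteq> x \<longrightarrow> (r x \<in> T \<longleftrightarrow> x \<notin> T)) \<and> (s x \<noteq> x \<longrightarrow> (s x \<in> T \<longleftrightarrow> x \<notin> T))"
    if r: "\<And>x. x \<in> X \<Longrightarrow> r x \<in> X \<and> r (r x) = x"
      and s: "\<And>x. x \<in> X \<Longrightarrow> s x \<in> X \<and> s (s x) = x"
      and x: "x \<in> X" "r x \<noteq> x" for r s x
  proof -
    define y where "y = r x"
    have y: "y \<in> X" "y \<noteq> x" "r y = x" using r x by (auto simp: y_def)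
    define X' where "X' = X - {x, y}"
    \<comment> \<open>The matching \<open>s\<close> without \<open>x\<close> and \<open>y\<close>, their partners being joined to each other.\<close>
    define s' where "s' z = (if s z = x then (if s y = y then z else s y)
      else if s z = y then (if s x = x then z else s x) else s z)" for z
    have card: "card X' < card X" unfolding X'_def
      using x(1) less.prems(1) by (intro psubset_card_mono) auto
    have r': "r z \<in> X' \<and> r (r z) = z" if "z \<in> X'" for z
    proof -
      have "z \<in> X" "z \<noteq> x" "z \<noteq> y" using that by (auto simp: X'_def)
      then show ?thesis using r[of z] y(3) y_def unfolding X'_def
        by (metis DiffI empty_iff insert_iff)
    qed
    have s': "s' z \<in> X' \<and> s' (s' z) = z" if "z \<in> X'" for z
    proof -
      have z: "z \<in> X" "z \<noteq> x" "z \<noteq> y" using that by (auto simp: X'_def)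
      note f = s[OF z(1)] s[OF x(1)] s[OF y(1)]
      consider "s z = x" | "s z = y" | "s z \<noteq> x" "s z \<noteq> y" by blast
      then show ?thesis
      proof cases
        case 1
        then have sx: "s x = z" using f by metis
        have "s y \<noteq> x" "s y \<noteq> z" using f 1 sx z y(2) by metis+
        then show ?thesis using 1 sx f z y(2) by (auto simp: s'_def X'_def)
      next
        case 2
        then have sy: "s y = z" using f by metis
        have "s x \<noteq> y" "s x \<noteq> z" using f 2 sy z y(2) by metis+
        then show ?thesis using 2 sy f z y(2) by (auto simp: s'_def X'_def)
      next
        case 3
        then show ?thesis using f z by (auto simp: s'_def X'_def)
      qed
    qed
    have "finite X'" using less.prems(1) by (simp add: X'_def)
    from less.hyps[OF card this r' s'] obtain T where
      T: "\<And>z. z \<in> X' \<Longrightarrow> (r z \<noteq> z \<longrightarrow> (r z \<in> T \<longleftrightarrow> z \<notin> T))"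
       "\<And>z. z \<in> X' \<Longrightarrow> (s' z \<noteq> z \<longrightarrow> (s' z \<in> T \<longleftrightarrow> z \<notin> T))"
      by blast
    \<comment> \<open>The colour that the partners of \<open>x\<close> and \<open>y\<close> force on \<open>x\<close>.\<close>
    define b where "b \<longleftrightarrow> (if s x \<in> X' then s x \<notin> T else if s y \<in> X' then s y \<in> T else True)"
    define T' where "T' = {z. if z = x then b else if z = y then \<not> b else z \<in> T}"
    have "(r z \<noteq> z \<longrightarrow> (r z \<in> T' \<longleftrightarrow> z \<notin> T')) \<and> (s z \<noteq> z \<longrightarrow> (s z \<in> T' \<longleftrightarrow> z \<notin> T'))"
      if z: "z \<in> X" for z
    proof
      show "r z \<noteq> z \<longrightarrow> (r z \<in> T' \<longleftrightarrow> z \<notin> T')"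
      proof (cases "z \<in> X'")
        case True
        then have "r z \<in> X'" using r' by blast
        then show ?thesis using T(1)[OF True] True by (auto simp: T'_def X'_def)
      next
        case False
        then have "z = x \<or> z = y" using z by (auto simp: X'_def)
        then show ?thesis using y y_def by (auto simp: T'_def)
      qed
      show "s z \<noteq> z \<longrightarrow> (s z \<in> T' \<longleftrightarrow> z \<notin> T')"
      proof (cases "z = x \<or> z = y")
        case True
        have T2: "s x \<in> X' \<Longrightarrow> s y \<in> X' \<Longrightarrow> (s y \<in> T) = (s x \<notin> T)"
          using T(2)[of "s x"] s[OF x(1)] s[OF y(1)] y(2) unfolding s'_def X'_def
          by (smt (verit) Diff_iff insertCI)
        have X': "s x \<in> X' \<longleftrightarrow> s x \<noteq> x \<and> s x \<noteq> y" "s y \<in> X' \<longleftrightarrow> s y \<noteq> x \<and> s y \<noteq> y"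
          using s x y unfolding X'_def by auto
        have "s x = y \<longleftrightarrow> s y = x" using s x y by metis
        then show ?thesis using True T2 X' y(2) unfolding T'_def b_def by auto
      next
        case False
        then have zX': "z \<in> X'" using z by (auto simp: X'_def)
        consider "s z = x" | "s z = y" | "s z \<noteq> x" "s z \<noteq> y" by blast
        then show ?thesis
        proof cases
          case 1
          then have "s x = z" using s z by metis
          then show ?thesis using 1 zX' False by (auto simp: T'_def b_def)
        next
          case 2
          then have sy: "s y = z" using s z by metis
          have "s x \<in> X' \<Longrightarrow> (z \<in> T) = (s x \<notin> T)"
            using T(2)[OF zX'] s[OF x(1)] y(2) 2 sy False unfolding s'_def X'_def
            by (smt (verit) Diff_iff insertCI)
          then show ?thesis using 2 sy zX' False y(2) by (auto simp: T'_def b_def)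
        next
          case 3
          then have "s' z = s z" by (simp add: s'_def)
          then show ?thesis using T(2)[OF zX'] 3 False by (auto simp: T'_def)
        qed
      qed
    qed
    then show ?thesis by blast
  qed
  show ?case
  proof (cases "\<exists>x\<in>X. p x \<noteq> x")
    case True
    then obtain x where x: "x \<in> X" "p x \<noteq> x" by blast
    show ?thesis by (rule step[OF less.prems(2,3) x])
  next
    case p: False
    show ?thesis
    proof (cases "\<exists>x\<in>X. q x \<noteq> x")
      case True
      then obtain x where x: "x \<in> X" "q x \<noteq> x" by blast
      have "\<exists>T. \<forall>x\<in>X. (q x \<noteq> x \<longrightarrow> (q x \<in> T) = (x \<notin> T)) \<and> (p x \<noteq> x \<longrightarrow> (p x \<in> T) = (x \<notin> T))"
        by (rule step[OF less.prems(3,2) x])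
      then show ?thesis by blast
    next
      case False
      then show ?thesis using p by blast
    qed
  qed
qed

lemma fibre_matching:
  assumes "finite X"
  shows "\<exists>p. (\<forall>x\<in>X. p x \<in> X \<and> p (p x) = x \<and> f (p x) = f x) \<and>
    (\<forall>x\<in>X. \<forall>y\<in>X. p x = x \<longrightarrow> p y = y \<longrightarrow> f x = f y \<longrightarrow> x = y)"
  using assms
proof (induction "card X" arbitrary: X rule: less_induct)
  case less
  show ?case
  proof (cases "\<exists>x\<in>X. \<exists>y\<in>X. x \<noteq> y \<and> f x = f y")
    case False
    then show ?thesis by (intro exI[of _ "\<lambda>x. x"]) blast
  next
    case True
    then obtain x y where xy: "x \<in> X" "y \<in> X" "x \<noteq> y" "f x = f y" by blast
    have "card (X - {x, y}) < card X" using xy less.prems by (intro psubset_card_mono) auto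
    from less.hyps[OF this] less.prems obtain p where
      p: "\<forall>z\<in>X - {x, y}. p z \<in> X - {x, y} \<and> p (p z) = z \<and> f (p z) = f z"
        "\<forall>z\<in>X - {x, y}. \<forall>w\<in>X - {x, y}. p z = z \<longrightarrow> p w = w \<longrightarrow> f z = f w \<longrightarrow> z = w"
      by (metis finite_Diff)
    define p' where "p' z = (if z = x then y else if z = y then x else p z)" for z
    have "p' z \<in> X \<and> p' (p' z) = z \<and> f (p' z) = f z" if "z \<in> X" for z
    proof (cases "z \<in> {x, y}")
      case True
      then show ?thesis using xy by (auto simp: p'_def)
    next
      case False
      then show ?thesis using p(1)[rule_format, of z] that by (auto simp: p'_def)
    qed
    moreover have "z = w" if "z \<in> X" "w \<in> X" "p' z = z" "p' w = w" "f z = f w" for z w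
    proof -
      have "z \<notin> {x, y}" "w \<notin> {x, y}" using that xy(3) by (auto simp: p'_def split: if_splits)
      moreover from this have "p z = z" "p w = w" using that by (auto simp: p'_def)
      ultimately show ?thesis using p(2)[rule_format, of z w] that by blast
    qed
    ultimately show ?thesis by blast
  qed
qed

text \<open>
  The matching exchanges the two colours on the part of \<open>P\<close> that it pairs up inside \<open>P\<close>, so an
  imbalance can come only from the other elements, of which there is at most one.
\<close>

lemma flipped_matching_balanced:
  assumes fin: "finite P"
    and p: "\<And>x. x \<in> P \<Longrightarrow> p (p x) = x"
    and flip: "\<And>x. x \<in> P \<Longrightarrow> p x \<noteq> x \<Longrightarrow> (p x \<in> T \<longleftrightarrow> x \<notin> T)"
    and single: "\<And>x y. x \<in> P \<Longrightarrow> y \<in> P \<Longrightarrow> p x \<notin> P \<or> p x = x \<Longrightarrow> p y \<notin> P \<or> p y = y \<Longrightarrow> x = y"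
  shows "card (P \<inter> T) \<le> card (P - T) + 1 \<and> card (P - T) \<le> card (P \<inter> T) + 1"
proof -
  define Q where "Q = {x \<in> P. p x \<in> P \<and> p x \<noteq> x}"
  have "bij_betw p (Q \<inter> T) (Q - T)"
    by (rule bij_betw_byWitness[where f' = p]) (use p flip in \<open>auto simp: Q_def\<close>)
  then have eq: "card (Q \<inter> T) = card (Q - T)" by (rule bij_betw_same_card)
  have "card (P - Q) \<le> 1"
  proof -
    have "x = y" if "x \<in> P - Q" "y \<in> P - Q" for x y
      using single[of x y] that by (auto simp: Q_def)
    then show ?thesis using card_le_Suc0_iff_eq[of "P - Q"] fin by simp
  qed
  moreover have "card (P \<inter> T) = card (Q \<inter> T) + card ((P - Q) \<inter> T)"
    "card (P - T) = card (Q - T) + card ((P - Q) - T)"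
    using fin by (subst card_Un_disjoint[symmetric]; auto simp: Q_def intro!: arg_cong[where f = card])+
  moreover have "card ((P - Q) \<inter> T) \<le> card (P - Q)" "card ((P - Q) - T) \<le> card (P - Q)"
    using fin by (auto intro!: card_mono)
  ultimately show ?thesis using eq by linarith
qed

definition halves :: "'a set set \<Rightarrow> 'a set \<Rightarrow> 'a set \<Rightarrow> bool" where
  "halves \<P> X T \<longleftrightarrow> (\<forall>P\<in>\<P>. card (P \<inter> X \<inter> T) \<le> card (P \<inter> X - T) + 1 \<and>
     card (P \<inter> X - T) \<le> card (P \<inter> X \<inter> T) + 1)"

text \<open>
  The two fibre systems of \<open>f'\<close> and \<open>f\<close> are nested, and one matching serves both: match within
  the fibres of \<open>f'\<close> first, and then match the leftovers, at most one for each of these fibres,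
  within the fibres of \<open>f\<close>. A second matching serves the fibres of \<open>g\<close>, and a proper 2-colouring
  of the union of the two matchings halves everything at once.
\<close>

lemma fibres_halved:
  assumes fin: "finite X"
    and finer: "\<And>x y. x \<in> X \<Longrightarrow> y \<in> X \<Longrightarrow> f' x = f' y \<Longrightarrow> f x = f y"
    and fibre: "\<And>P. P \<in> \<P> \<Longrightarrow> (\<exists>z. P \<inter> X = {x\<in>X. f' x = z}) \<or> (\<exists>z. P \<inter> X = {x\<in>X. f x = z}) \<or>
      (\<exists>z. P \<inter> X = {x\<in>X. g x = z})"
  shows "\<exists>T. halves \<P> X T"
proof -
  obtain p1 where p1: "\<forall>x\<in>X. p1 x \<in> X \<and> p1 (p1 x) = x \<and> f' (p1 x) = f' x"
     "\<forall>x\<in>X. \<forall>y\<in>X. p1 x = x \<longrightarrow> p1 y = y \<longrightarrow> f' x = f' y \<longrightarrow> x = y"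
    using fibre_matching[OF fin, of f'] by blast
  define Z where "Z = {x\<in>X. p1 x = x}"
  have "finite Z" using fin by (simp add: Z_def)
  then obtain p2 where p2: "\<forall>x\<in>Z. p2 x \<in> Z \<and> p2 (p2 x) = x \<and> f (p2 x) = f x"
     "\<forall>x\<in>Z. \<forall>y\<in>Z. p2 x = x \<longrightarrow> p2 y = y \<longrightarrow> f x = f y \<longrightarrow> x = y"
    using fibre_matching[of Z f] by blast
  define p where "p x = (if x \<in> Z then p2 x else p1 x)" for x
  obtain q where q: "\<forall>x\<in>X. q x \<in> X \<and> q (q x) = x \<and> g (q x) = g x"
     "\<forall>x\<in>X. \<forall>y\<in>X. q x = x \<longrightarrow> q y = y \<longrightarrow> g x = g y \<longrightarrow> x = y"
    using fibre_matching[OF fin, of g] by blast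
  have p: "p x \<in> X \<and> p (p x) = x" if "x \<in> X" for x
  proof (cases "x \<in> Z")
    case True
    then show ?thesis using p2(1)[rule_format, OF True] by (auto simp: p_def Z_def)
  next
    case False
    then have "p1 x \<notin> Z" using p1(1)[rule_format, OF that] that by (auto simp: Z_def)
    then show ?thesis using False p1(1)[rule_format, OF that] by (simp add: p_def)
  qed
  have q': "q x \<in> X \<and> q (q x) = x" if "x \<in> X" for x
    using q(1)[rule_format, OF that] by simp
  from two_matchings_bipartite[OF fin p q'] obtain T where
    T: "\<And>x. x \<in> X \<Longrightarrow> p x \<noteq> x \<Longrightarrow> (p x \<in> T \<longleftrightarrow> x \<notin> T)"
     "\<And>x. x \<in> X \<Longrightarrow> q x \<noteq> x \<Longrightarrow> (q x \<in> T \<longleftrightarrow> x \<notin> T)"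
    by blast
  have "card (P \<inter> X \<inter> T) \<le> card (P \<inter> X - T) + 1 \<and> card (P \<inter> X - T) \<le> card (P \<inter> X \<inter> T) + 1"
    if "P \<in> \<P>" for P
    using fibre[OF that]
  proof (elim disjE exE)
    fix z assume z: "P \<inter> X = {x\<in>X. f' x = z}"
    show ?thesis unfolding z
    proof (rule flipped_matching_balanced[where p = p])
      fix x y assume "x \<in> {x\<in>X. f' x = z}" "y \<in> {x\<in>X. f' x = z}"
        and "p x \<notin> {x\<in>X. f' x = z} \<or> p x = x" "p y \<notin> {x\<in>X. f' x = z} \<or> p y = y"
      moreover from this have "x \<in> Z" "y \<in> Z"
        using p1(1)[rule_format, of x] p1(1)[rule_format, of y] unfolding p_def Z_def
        by (auto split: if_splits)
      ultimately show "x = y" using p1(2)[rule_format, of x y] by (simp add: Z_def)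
    qed (use fin p T in \<open>simp_all\<close>)
  next
    fix z assume z: "P \<inter> X = {x\<in>X. f x = z}"
    show ?thesis unfolding z
    proof (rule flipped_matching_balanced[where p = p])
      fix x y assume *: "x \<in> {x\<in>X. f x = z}" "y \<in> {x\<in>X. f x = z}"
        "p x \<notin> {x\<in>X. f x = z} \<or> p x = x" "p y \<notin> {x\<in>X. f x = z} \<or> p y = y"
      have "w \<in> Z \<and> p2 w = w" if "w \<in> {x\<in>X. f x = z}" "p w \<notin> {x\<in>X. f x = z} \<or> p w = w" for w
        using that p1(1)[rule_format, of w] p2(1)[rule_format, of w] finer[of "p1 w" w]
        unfolding p_def Z_def by (auto split: if_splits)
      from this[of x] this[of y] show "x = y" using p2(2)[rule_format, of x y] * by simp
    qed (use fin p T in \<open>simp_all\<close>)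
  next
    fix z assume z: "P \<inter> X = {x\<in>X. g x = z}"
    show ?thesis unfolding z
    proof (rule flipped_matching_balanced[where p = q])
      fix x y assume "x \<in> {x\<in>X. g x = z}" "y \<in> {x\<in>X. g x = z}"
        "q x \<notin> {x\<in>X. g x = z} \<or> q x = x" "q y \<notin> {x\<in>X. g x = z} \<or> q y = y"
      then show "x = y"
        using q(1)[rule_format, of x] q(1)[rule_format, of y] q(2)[rule_format, of x y] by simp
    qed (use fin q' T in \<open>simp_all\<close>)
  qed
  then show ?thesis unfolding halves_def by blast
qed

text \<open>
  Two colours suffice for \<open>k\<close> colours: in a colouring that minimises the sum of the squares of all
  class sizes, redistribute the elements of any two colours by an even split. No sum of two squares
  goes up, and it goes strictly down where the two class sizes differed by more than one, so by
  minimality they differ by at most one on every member of \<open>\<P>\<close>.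
\<close>

lemma equitable_colouring:
  fixes \<P> :: "'a set set" and k :: nat
  assumes fin: "finite E" "finite \<P>" and k: "k > 0"
    and halved: "\<And>X. X \<subseteq> E \<Longrightarrow> \<exists>T. halves \<P> X T"
  shows "\<exists>col. (\<forall>e. col e < k) \<and>
    (\<forall>P\<in>\<P>. \<forall>a<k. \<forall>b<k. card {e\<in>P \<inter> E. col e = a} \<le> card {e\<in>P \<inter> E. col e = b} + 1)"
proof -
  define N where "N col P a = card {e\<in>P \<inter> E. col e = a}" for col :: "'a \<Rightarrow> nat" and P a
  define \<Phi> where "\<Phi> col = (\<Sum>P\<in>\<P>. \<Sum>a<k. (N col P a)\<^sup>2)" for col
  obtain col where col: "\<And>e. col e < k" and least: "\<And>col'. (\<And>e. col' e < k) \<Longrightarrow> \<Phi> col \<le> \<Phi> col'"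
    using ex_has_least_nat[of "\<lambda>col. \<forall>e. col e < k" "\<lambda>_. 0" \<Phi>] k by blast
  have "N col P0 a \<le> N col P0 b + 1" if P0: "P0 \<in> \<P>" and ab: "a < k" "b < k" for P0 a b
  proof (rule ccontr)
    assume neg: "\<not> N col P0 a \<le> N col P0 b + 1"
    then have "a \<noteq> b" by auto
    define X where "X = {e\<in>E. col e = a \<or> col e = b}"
    obtain T where T: "halves \<P> X T" using halved[of X] by (auto simp: X_def)
    define col' where "col' e = (if e \<in> X then if e \<in> T then a else b else col e)" for e
    have col': "col' e < k" for e using ab col by (simp add: col'_def)
    have split: "(\<Sum>d<k. h d) = h a + h b + (\<Sum>d\<in>{..<k} - {a, b}. h d)" for h :: "nat \<Rightarrow> nat"
    proof -
      have "(\<Sum>d<k. h d) = (\<Sum>d\<in>{a,b}. h d) + (\<Sum>d\<in>{..<k} - {a, b}. h d)"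
        using ab by (intro sum.subset_diff[of "{a,b}", THEN trans]) auto
      then show ?thesis using \<open>a \<noteq> b\<close> by simp
    qed
    have other: "N col' P d = N col P d" if "d \<notin> {a, b}" for P d
      unfolding N_def using that by (intro arg_cong[where f = card]) (auto simp: col'_def X_def)
    have a': "N col' P a = card (P \<inter> X \<inter> T)" and b': "N col' P b = card (P \<inter> X - T)" for P
      unfolding N_def using \<open>a \<noteq> b\<close>
      by (auto intro!: arg_cong[where f = card] simp: col'_def X_def split: if_splits)
    have finX: "finite X" using fin by (simp add: X_def)
    have tot: "N col' P a + N col' P b = N col P a + N col P b" for P
    proof -
      have "N col' P a + N col' P b = card (P \<inter> X)"
        unfolding a' b' using finX
        by (subst card_Un_disjoint[symmetric]) (auto intro!: arg_cong[where f = card])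
      also have "\<dots> = N col P a + N col P b"
        unfolding N_def using fin \<open>a \<noteq> b\<close>
        by (subst card_Un_disjoint[symmetric]) (auto intro!: arg_cong[where f = card] simp: X_def)
      finally show ?thesis .
    qed
    have near: "N col' P a \<le> N col' P b + 1 \<and> N col' P b \<le> N col' P a + 1" if "P \<in> \<P>" for P
      using T that unfolding halves_def a' b' by blast
    \<comment> \<open>The new sizes \<open>s\<close>, \<open>t\<close> of the two classes against the old sizes \<open>u\<close>, \<open>v\<close>.\<close>
    have sq: "(s::nat)\<^sup>2 + t\<^sup>2 \<le> u\<^sup>2 + v\<^sup>2 \<and> (u > v + 1 \<longrightarrow> s\<^sup>2 + t\<^sup>2 < u\<^sup>2 + v\<^sup>2)"
      if "s + t = u + v" "s \<le> t + 1" "t \<le> s + 1" for s t u v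
    proof -
      define d :: int where "d = int u - int s"
      have e: "int u = int s + d" "int v = int t - d" using that(1) by (auto simp: d_def)
      have "(int u)\<^sup>2 + (int v)\<^sup>2 - ((int s)\<^sup>2 + (int t)\<^sup>2) = 2 * (d * (d + int s - int t))"
        unfolding e by algebra
      moreover have "d * (d + int s - int t) \<ge> 0"
      proof (cases "d \<ge> 1")
        case True then show ?thesis using that by (intro mult_nonneg_nonneg) auto
      next
        case False
        show ?thesis
        proof (cases "d = 0")
          case False then show ?thesis using \<open>\<not> d \<ge> 1\<close> that by (intro mult_nonpos_nonpos) auto
        qed simp
      qed
      moreover have "d * (d + int s - int t) > 0" if "u > v + 1"
      proof -
        have "2 * d + int s - int t > 1" using that e by linarith
        then have "d > 0" "d + int s - int t > 0" using \<open>s \<le> t + 1\<close> \<open>t \<le> s + 1\<close> by linarith+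
        then show ?thesis by simp
      qed
      ultimately have "(int s)\<^sup>2 + (int t)\<^sup>2 \<le> (int u)\<^sup>2 + (int v)\<^sup>2 \<and>
          (u > v + 1 \<longrightarrow> (int s)\<^sup>2 + (int t)\<^sup>2 < (int u)\<^sup>2 + (int v)\<^sup>2)" by linarith
      then show ?thesis by (simp flip: of_nat_power of_nat_add)
    qed
    have rest: "(\<Sum>d\<in>{..<k} - {a, b}. (N col' P d)\<^sup>2) = (\<Sum>d\<in>{..<k} - {a, b}. (N col P d)\<^sup>2)" for P
      using other by (intro sum.cong) auto
    have "\<Phi> col' < \<Phi> col" unfolding \<Phi>_def
    proof (rule sum_strict_mono_ex1[OF fin(2)])
      show "\<forall>P\<in>\<P>. (\<Sum>a<k. (N col' P a)\<^sup>2) \<le> (\<Sum>a<k. (N col P a)\<^sup>2)"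
        using sq[OF tot] near unfolding split rest by (simp add: conj_commute)
      show "\<exists>P\<in>\<P>. (\<Sum>a<k. (N col' P a)\<^sup>2) < (\<Sum>a<k. (N col P a)\<^sup>2)"
        using sq[OF tot, of P0] near[OF P0] P0 neg unfolding split rest
        by (intro bexI[of _ P0]) (auto simp: conj_commute)
    qed
    then show False using least[of col'] col' by (simp add: leD)
  qed
  then show ?thesis using col unfolding N_def by blast
qed

lemma equal_shares:
  fixes N :: "nat \<Rightarrow> nat"
  assumes sum: "(\<Sum>a<k. N a) = k * q" and near: "\<And>a b. a < k \<Longrightarrow> b < k \<Longrightarrow> N a \<le> N b + 1" and a: "a < k"
  shows "N a = q"
proof (rule ccontr)
  assume "N a \<noteq> q"
  then consider "N a < q" | "N a > q" by linarith
  then show False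
  proof cases
    case 1
    have "(\<Sum>b<k. N b) < (\<Sum>b<k. q)"
      by (rule sum_strict_mono_ex1) (use 1 near[OF _ a] a in fastforce)+
    then show False using sum by simp
  next
    case 2
    have "(\<Sum>b<k. q) < (\<Sum>b<k. N b)"
      by (rule sum_strict_mono_ex1) (use 2 near[OF a] a in fastforce)+
    then show False using sum by simp
  qed
qed

section \<open>Fair shares and connectedness\<close>

text \<open>
  One class of an equitable \<open>k\<close>-colouring is a fair \<open>k\<close>-th part of \<open>U\<close>. Class sizes within a fibre
  differ by at most one, so they are equal when \<open>k\<close> divides the size of the fibre, and a fibre
  with two or more elements cannot lie within one of at least two classes. The latter property is
  what keeps subgraphs connected when a vertex is split.
\<close>

lemma fair_share:
  fixes k :: nat
  assumes fin: "finite U" and k: "k \<ge> 2"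
    and finer: "\<And>x y. x \<in> U \<Longrightarrow> y \<in> U \<Longrightarrow> f' x = f' y \<Longrightarrow> f x = f y"
  shows "\<exists>S\<subseteq>U. (\<forall>z q. card {e\<in>U. f e = z} = k * q \<longrightarrow> card {e\<in>S. f e = z} = q) \<and>
    (\<forall>z q. card {e\<in>U. g e = z} = k * q \<longrightarrow> card {e\<in>S. g e = z} = q) \<and>
    (\<forall>z. card {e\<in>U. f' e = z} \<ge> 2 \<longrightarrow> (\<exists>e\<in>U - S. f' e = z))"
proof -
  define \<P> where "\<P> = (\<lambda>e. {x\<in>U. f' x = f' e}) ` U \<union> (\<lambda>e. {x\<in>U. f x = f e}) ` U \<union>
    (\<lambda>e. {x\<in>U. g x = g e}) ` U"
  have "\<exists>T. halves \<P> X T" if X: "X \<subseteq> U" for X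
  proof (rule fibres_halved)
    show "finite X" using X fin by (rule finite_subset)
    show "f x = f y" if "x \<in> X" "y \<in> X" "f' x = f' y" for x y using finer that X by blast
    show "(\<exists>z. P \<inter> X = {x\<in>X. f' x = z}) \<or> (\<exists>z. P \<inter> X = {x\<in>X. f x = z}) \<or>
      (\<exists>z. P \<inter> X = {x\<in>X. g x = z})" if P: "P \<in> \<P>" for P
    proof -
      have eqf: "{x\<in>U. f x = f e} \<inter> X = {x\<in>X. f x = f e}"
        "{x\<in>U. g x = g e} \<inter> X = {x\<in>X. g x = g e}"
        "{x\<in>U. f' x = f' e} \<inter> X = {x\<in>X. f' x = f' e}" for e
        using X by blast+
      show ?thesis using P unfolding \<P>_def
        by (elim UnE imageE; simp only: eqf) blast+
    qed
  qed
  note halved = this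
  have finP: "finite \<P>" using fin by (simp add: \<P>_def)
  have "k > 0" using k by simp
  from equitable_colouring[OF fin finP this halved] obtain col where col: "\<And>e. col e < k"
    and eq: "\<And>P a b. P \<in> \<P> \<Longrightarrow> a < k \<Longrightarrow> b < k \<Longrightarrow>
      card {e\<in>P \<inter> U. col e = a} \<le> card {e\<in>P \<inter> U. col e = b} + 1"
    by blast
  define S where "S = {e\<in>U. col e = 0}"
  have share: "card {e\<in>S. h e = z} = q"
    if mem: "\<And>e. e \<in> U \<Longrightarrow> {x\<in>U. h x = h e} \<in> \<P>" and q: "card {e\<in>U. h e = z} = k * q"
    for h :: "'a \<Rightarrow> 'z" and z q
  proof (cases "\<exists>e\<in>U. h e = z")
    case False
    then have "{e\<in>U. h e = z} = {}" "{e\<in>S. h e = z} = {}" by (auto simp: S_def)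
    then have "k * q = 0" "card {e\<in>S. h e = z} = 0" using q by (simp_all only: card.empty)
    then show ?thesis using k by simp
  next
    case True
    then have P: "{e\<in>U. h e = z} \<in> \<P>" using mem by blast
    define N where "N a = card {e\<in>{e\<in>U. h e = z} \<inter> U. col e = a}" for a
    have "(\<Sum>a<k. N a) = card (\<Union>a<k. {e\<in>{e\<in>U. h e = z} \<inter> U. col e = a})"
      unfolding N_def using fin by (subst card_UN_disjoint) auto
    also have "(\<Union>a<k. {e\<in>{e\<in>U. h e = z} \<inter> U. col e = a}) = {e\<in>U. h e = z}" using col by auto
    finally have "(\<Sum>a<k. N a) = k * q" using q by simp
    then have "N 0 = q" using equal_shares[of N k q 0] eq[OF P] k by (simp add: N_def)
    moreover have "{e\<in>{e\<in>U. h e = z} \<inter> U. col e = 0} = {e\<in>S. h e = z}" by (auto simp: S_def)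
    ultimately show ?thesis by (simp add: N_def)
  qed
  show ?thesis
  proof (intro exI[of _ S] conjI allI impI)
    show "S \<subseteq> U" by (auto simp: S_def)
    show "card {e\<in>S. f e = z} = q" if "card {e\<in>U. f e = z} = k * q" for z q
      by (rule share[OF _ that]) (auto simp: \<P>_def)
    show "card {e\<in>S. g e = z} = q" if "card {e\<in>U. g e = z} = k * q" for z q
      by (rule share[OF _ that]) (auto simp: \<P>_def)
    show "\<exists>e\<in>U - S. f' e = z" if two: "card {e\<in>U. f' e = z} \<ge> 2" for z
    proof (rule ccontr)
      assume none: "\<not> ?thesis"
      define P where "P = {e\<in>U. f' e = z}"
      have "P \<noteq> {}" using two unfolding P_def by (metis card.empty not_numeral_le_zero)
      then obtain e where "e \<in> U" "f' e = z" by (auto simp: P_def)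
      then have "P \<in> \<P>" by (auto simp: \<P>_def P_def)
      moreover have "{e\<in>P \<inter> U. col e = 0} = P" "{e\<in>P \<inter> U. col e = 1} = {}"
        using none by (auto simp: P_def S_def)
      moreover have "0 < k" "1 < k" using k by simp_all
      ultimately have "card P \<le> 1" using eq[of P 0 1] by (simp only: card.empty add_0)
      then show False using two by (simp add: P_def)
    qed
  qed
qed

text \<open>
  Connectedness as a property of an edge set \<open>A\<close> alone: no nonempty proper part of \<open>A\<close> is closed
  under taking edges that share a vertex. Vertices that meet no edge of \<open>A\<close> are ignored, and no
  walks need to be built to establish it.
\<close>

definition edge_connected :: "('e \<Rightarrow> 'v set) \<Rightarrow> 'e set \<Rightarrow> bool" where
  "edge_connected \<phi> A \<longleftrightarrow>
     (\<forall>B\<subseteq>A. B \<noteq> {} \<longrightarrow> (\<forall>e\<in>B. \<forall>e'\<in>A. \<phi> e \<inter> \<phi> e' \<noteq> {} \<longrightarrow> e' \<in> B) \<longrightarrow> B = A)"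

lemma edge_connectedD:
  assumes "edge_connected \<phi> A" "B \<subseteq> A" "B \<noteq> {}"
    and "\<And>e e'. e \<in> B \<Longrightarrow> e' \<in> A \<Longrightarrow> \<phi> e \<inter> \<phi> e' \<noteq> {} \<Longrightarrow> e' \<in> B"
  shows "B = A"
  using assms(1)[unfolded edge_connected_def, rule_format, OF assms(2,3)] assms(4) by simp

text \<open>
  The handshake lemma: the degrees have even sum.
\<close>

lemma even_degree_at_exceptional_vertex:
  assumes fin: "finite Q" and two: "\<And>e. e \<in> Q \<Longrightarrow> card (\<phi> e) = 2"
    and even: "\<And>v. v \<noteq> x \<Longrightarrow> even (card {e\<in>Q. v \<in> \<phi> e})"
  shows "even (card {e\<in>Q. x \<in> \<phi> e})"
proof -
  define W where "W = insert x (\<Union>e\<in>Q. \<phi> e)"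
  have finW: "finite W" unfolding W_def using fin two by (auto intro: card_ge_0_finite)
  have total: "(\<Sum>v\<in>W. card {e\<in>Q. v \<in> \<phi> e}) = 2 * card Q"
  proof (rule sum_multicount[OF finW fin], intro ballI)
    fix e assume e: "e \<in> Q"
    then have "{v\<in>W. v \<in> \<phi> e} = \<phi> e" by (auto simp: W_def)
    then show "card {v\<in>W. v \<in> \<phi> e} = 2" using two[OF e] by simp
  qed
  have split: "(\<Sum>v\<in>W. card {e\<in>Q. v \<in> \<phi> e}) =
      card {e\<in>Q. x \<in> \<phi> e} + (\<Sum>v\<in>W - {x}. card {e\<in>Q. v \<in> \<phi> e})"
    by (rule sum.remove[OF finW]) (simp add: W_def)
  have "even (\<Sum>v\<in>W - {x}. card {e\<in>Q. v \<in> \<phi> e})"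
    using even by (intro dvd_sum) auto
  moreover have "even (card {e\<in>Q. x \<in> \<phi> e} + (\<Sum>v\<in>W - {x}. card {e\<in>Q. v \<in> \<phi> e}))"
    unfolding split[symmetric] total by simp
  ultimately show ?thesis by simp
qed

text \<open>
  The component of the edge \<open>e\<close> when the vertex \<open>x\<close> is pulled apart completely, so that two
  edges are no longer linked by sharing \<open>x\<close> only.
\<close>

definition away_component :: "('e \<Rightarrow> 'v set) \<Rightarrow> 'v \<Rightarrow> 'e set \<Rightarrow> 'e \<Rightarrow> 'e set" where
  "away_component \<phi> x A e = {(a, b). a \<in> A \<and> b \<in> A \<and> \<phi> a \<inter> \<phi> b - {x} \<noteq> {}}\<^sup>* `` {e}"

lemma away_component_refl: "e \<in> away_component \<phi> x A e"
  by (simp add: away_component_def)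

lemma away_component_subset: "e \<in> A \<Longrightarrow> away_component \<phi> x A e \<subseteq> A"
proof
  fix a assume "e \<in> A" "a \<in> away_component \<phi> x A e"
  then have "(e, a) \<in> {(a, b). a \<in> A \<and> b \<in> A \<and> \<phi> a \<inter> \<phi> b - {x} \<noteq> {}}\<^sup>*"
    by (simp add: away_component_def)
  then show "a \<in> A" using \<open>e \<in> A\<close> by (induction rule: rtrancl_induct) auto
qed

lemma away_component_closed:
  assumes "a \<in> away_component \<phi> x A e" "a \<in> A" "b \<in> A" "v \<in> \<phi> a" "v \<in> \<phi> b" "v \<noteq> x"
  shows "b \<in> away_component \<phi> x A e"
  using assms unfolding away_component_def
  by (auto intro: rtrancl_into_rtrancl)

lemma away_component_eq:
  assumes "a \<in> away_component \<phi> x A e"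
  shows "away_component \<phi> x A a = away_component \<phi> x A e"
proof -
  have "sym ({(a, b). a \<in> A \<and> b \<in> A \<and> \<phi> a \<inter> \<phi> b - {x} \<noteq> {}}\<^sup>*)"
    by (intro sym_rtrancl) (auto simp: sym_def)
  then show ?thesis using assms unfolding away_component_def
    by (auto dest: symD intro: rtrancl_trans)
qed

lemma away_component_least:
  assumes "e \<in> B" "\<And>a b v. a \<in> B \<Longrightarrow> b \<in> A \<Longrightarrow> v \<in> \<phi> a \<Longrightarrow> v \<in> \<phi> b \<Longrightarrow> v \<noteq> x \<Longrightarrow> b \<in> B"
  shows "away_component \<phi> x A e \<subseteq> B"
proof
  fix a assume "a \<in> away_component \<phi> x A e"
  then have "(e, a) \<in> {(a, b). a \<in> A \<and> b \<in> A \<and> \<phi> a \<inter> \<phi> b - {x} \<noteq> {}}\<^sup>*"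
    by (simp add: away_component_def)
  then show "a \<in> B" using assms by (induction rule: rtrancl_induct) auto
qed

text \<open>
  Away from \<open>x\<close> a component contains all or none of the edges of \<open>A\<close> at a vertex, so its degrees
  there are even, and by parity so is its degree at \<open>x\<close>.
\<close>

lemma away_component_even:
  assumes fin: "finite A" and two: "\<And>e. e \<in> A \<Longrightarrow> card (\<phi> e) = 2"
    and even: "\<And>v. even (card {e\<in>A. v \<in> \<phi> e})" and e: "e \<in> A"
  shows "even (card {a\<in>away_component \<phi> x A e. x \<in> \<phi> a})"
proof (rule even_degree_at_exceptional_vertex)
  note sub = away_component_subset[OF e, of \<phi> x]
  show "finite (away_component \<phi> x A e)" using sub fin by (rule finite_subset)
  show "card (\<phi> a) = 2" if "a \<in> away_component \<phi> x A e" for a using that sub two by blast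
  show "even (card {a\<in>away_component \<phi> x A e. v \<in> \<phi> a})" if "v \<noteq> x" for v
  proof (cases "\<exists>a\<in>away_component \<phi> x A e. v \<in> \<phi> a")
    case True
    then have "{a\<in>away_component \<phi> x A e. v \<in> \<phi> a} = {a\<in>A. v \<in> \<phi> a}"
      using away_component_closed[of _ \<phi> x A e _ v] sub that by blast
    then show ?thesis using even by simp
  next
    case False
    then have "{a\<in>away_component \<phi> x A e. v \<in> \<phi> a} = {}" by blast
    then show ?thesis by (metis card.empty even_zero)
  qed
qed

definition move_end :: "'e set \<Rightarrow> 'v \<Rightarrow> 'v \<Rightarrow> ('e \<Rightarrow> 'v set) \<Rightarrow> 'e \<Rightarrow> 'v set" where
  "move_end S x y \<phi> e = (if e \<in> S then insert y (\<phi> e - {x}) else \<phi> e)"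

text \<open>
  Moving the \<open>x\<close>-ends of the edges in \<open>S\<close> to a new vertex \<open>y\<close> preserves connectedness as soon as
  every component that has two or more edges at \<open>x\<close> keeps one of them. Indeed, if \<open>x\<close> lies on an edge
  at all, then each component has at least one edge at \<open>x\<close> by connectedness, hence at least two by
  parity, hence after the move all components still meet at \<open>x\<close>.
\<close>

lemma edge_connected_move_end:
  assumes fin: "finite A" and two: "\<And>e. e \<in> A \<Longrightarrow> card (\<phi> e) = 2"
    and even: "\<And>v. even (card {e\<in>A. v \<in> \<phi> e})"
    and new: "\<And>e. e \<in> A \<Longrightarrow> y \<notin> \<phi> e"
    and S: "\<And>e. e \<in> A \<Longrightarrow> e \<in> S \<Longrightarrow> x \<in> \<phi> e"
    and left: "\<And>e. e \<in> A \<Longrightarrow> card {a\<in>away_component \<phi> x A e. x \<in> \<phi> a} \<ge> 2 \<Longrightarrow>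
      \<exists>a\<in>away_component \<phi> x A e. x \<in> \<phi> a \<and> a \<notin> S"
    and conn: "edge_connected \<phi> A"
  shows "edge_connected (move_end S x y \<phi>) A"
proof (cases "\<exists>e\<in>A. x \<in> \<phi> e")
  case False
  then have same: "move_end S x y \<phi> e = \<phi> e" if "e \<in> A" for e
    using S that by (auto simp: move_end_def)
  show ?thesis unfolding edge_connected_def
  proof (intro allI impI)
    fix B assume B: "B \<subseteq> A" "B \<noteq> {}"
      and closed: "\<forall>e\<in>B. \<forall>e'\<in>A. move_end S x y \<phi> e \<inter> move_end S x y \<phi> e' \<noteq> {} \<longrightarrow> e' \<in> B"
    show "B = A"
    proof (rule edge_connectedD[OF conn B])
      fix a b assume "a \<in> B" "b \<in> A" "\<phi> a \<inter> \<phi> b \<noteq> {}"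
      then show "b \<in> B" using closed[rule_format, of a b] same[of a] same[of b] B(1) by auto
    qed
  qed
next
  case True
  let ?C = "away_component \<phi> x A"
  have reach: "\<exists>a\<in>?C e. x \<in> \<phi> a \<and> a \<notin> S" if e: "e \<in> A" for e
  proof (rule left[OF e])
    note sub = away_component_subset[OF e, of \<phi> x]
    have "\<exists>a\<in>?C e. x \<in> \<phi> a"
    proof (rule ccontr)
      assume none: "\<not> ?thesis"
      have "?C e = A"
      proof (rule edge_connectedD[OF conn sub])
        show "?C e \<noteq> {}" using away_component_refl by fastforce
        fix a b assume "a \<in> ?C e" "b \<in> A" "\<phi> a \<inter> \<phi> b \<noteq> {}"
        then obtain v where "v \<in> \<phi> a" "v \<in> \<phi> b" by blast
        then show "b \<in> ?C e"
          using away_component_closed[of a \<phi> x A e b v] \<open>a \<in> ?C e\<close> \<open>b \<in> A\<close> none sub by blast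
      qed
      then show False using none True by blast
    qed
    moreover have "finite (?C e)" using sub fin by (rule finite_subset)
    ultimately have "card {a\<in>?C e. x \<in> \<phi> a} > 0" by (auto simp: card_gt_0_iff)
    moreover have "even (card {a\<in>?C e. x \<in> \<phi> a})"
      by (rule away_component_even[OF fin two even e])
    ultimately show "card {a\<in>?C e. x \<in> \<phi> a} \<ge> 2" by (cases "card {a\<in>?C e. x \<in> \<phi> a}") (auto elim: oddE)
  qed
  show ?thesis unfolding edge_connected_def
  proof (intro allI impI)
    fix B assume B: "B \<subseteq> A" "B \<noteq> {}"
      and closed: "\<forall>e\<in>B. \<forall>e'\<in>A. move_end S x y \<phi> e \<inter> move_end S x y \<phi> e' \<noteq> {} \<longrightarrow> e' \<in> B"
    have away: "b \<in> B" if "a \<in> B" "b \<in> A" "v \<in> \<phi> a" "v \<in> \<phi> b" "v \<noteq> x" for a b v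
    proof -
      have "v \<in> move_end S x y \<phi> a \<inter> move_end S x y \<phi> b" using that by (auto simp: move_end_def)
      then show ?thesis using closed that by blast
    qed
    have comp: "?C e \<subseteq> B" if "e \<in> B" for e
      by (rule away_component_least[OF that]) (rule away)
    obtain e0 where e0: "e0 \<in> B" using B by blast
    then obtain a0 where a0: "a0 \<in> B" "x \<in> \<phi> a0" "a0 \<notin> S"
      using reach[of e0] comp[OF e0] B by blast
    have "e \<in> B" if e: "e \<in> A" for e
    proof -
      obtain a where a: "a \<in> ?C e" "x \<in> \<phi> a" "a \<notin> S" using reach[OF e] by blast
      have "a \<in> A" using a(1) away_component_subset[OF e, of \<phi> x] by (rule rev_subsetD)
      moreover have "x \<in> move_end S x y \<phi> a0 \<inter> move_end S x y \<phi> a"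
        using a a0 by (simp add: move_end_def)
      ultimately have "a \<in> B" using closed a0 by blast
      then have "?C e \<subseteq> B" using comp[of a] away_component_eq[OF a(1)] by simp
      then show "e \<in> B" using away_component_refl by fastforce
    qed
    then show "B = A" using B by blast
  qed
qed

section \<open>Splitting vertices\<close>

text \<open>
  The invariant of the splitting process. Each vertex \<open>v\<close> belongs to the part \<open>part v\<close> and stands for
  \<open>\<eta> v\<close> final vertices, weight \<open>0\<close> marking names that are not in use. Edge \<open>e\<close> has class \<open>cl e\<close>;
  class degrees are proportional to the weight, with factor \<open>D\<close>, and multiplicities are proportional
  to the product of the weights, with factor \<open>M\<close>. The classes in \<open>C\<close> are to stay connected.
\<close>

definition fair_detachment ::
  "'e set \<Rightarrow> ('e \<Rightarrow> 'c) \<Rightarrow> 'c set \<Rightarrow> ('v \<Rightarrow> 'p) \<Rightarrow> ('c \<Rightarrow> 'p \<Rightarrow> nat) \<Rightarrow> ('p \<Rightarrow> 'p \<Rightarrow> nat) \<Rightarrow>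
    ('v \<Rightarrow> nat) \<Rightarrow> ('e \<Rightarrow> 'v set) \<Rightarrow> bool" where
  "fair_detachment E cl C part D M \<eta> \<phi> \<longleftrightarrow>
     (\<forall>e\<in>E. card (\<phi> e) = 2) \<and>
     (\<forall>c v. card {e\<in>E. cl e = c \<and> v \<in> \<phi> e} = D c (part v) * \<eta> v) \<and>
     (\<forall>u v. u \<noteq> v \<longrightarrow> card {e\<in>E. \<phi> e = {u, v}} = M (part u) (part v) * \<eta> u * \<eta> v) \<and>
     (\<forall>c\<in>C. edge_connected \<phi> {e\<in>E. cl e = c})"

text \<open>
  One unit of weight is split off \<open>x\<close>. The moved edges are a fair \<open>\<eta> x\<close>-th part of the edges at
  \<open>x\<close>, with respect to their classes (which settles the degrees), to their end pairs (which settles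
  the multiplicities) and to the components that remain in each class without \<open>x\<close> (which keeps the
  classes in \<open>C\<close> connected). Components refine classes, so a fair part exists.
\<close>

lemma split_vertex:
  assumes fin: "finite E"
    and even: "\<And>c p. c \<in> C \<Longrightarrow> even (D c p)"
    and M: "\<And>p q. M p q = M q p" "\<And>p. M p p = 0"
    and fd: "fair_detachment E cl C part D M \<eta> \<phi>"
    and x: "\<eta> x \<ge> 2" and y: "\<eta> y = 0" "part y = part x"
  shows "\<exists>\<phi>'. fair_detachment E cl C part D M (\<eta>(x := \<eta> x - 1, y := 1)) \<phi>'"
proof -
  have two: "\<And>e. e \<in> E \<Longrightarrow> card (\<phi> e) = 2"
    and deg: "\<And>c v. card {e\<in>E. cl e = c \<and> v \<in> \<phi> e} = D c (part v) * \<eta> v"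
    and mult: "\<And>u v. u \<noteq> v \<Longrightarrow> card {e\<in>E. \<phi> e = {u, v}} = M (part u) (part v) * \<eta> u * \<eta> v"
    and conn: "\<And>c. c \<in> C \<Longrightarrow> edge_connected \<phi> {e\<in>E. cl e = c}"
    using fd unfolding fair_detachment_def by blast+
  have xy: "x \<noteq> y" using x y by auto
  have new: "y \<notin> \<phi> e" if e: "e \<in> E" for e
  proof
    assume "y \<in> \<phi> e"
    then have "e \<in> {a\<in>E. cl a = cl e \<and> y \<in> \<phi> a}" using e by simp
    moreover have "card {a\<in>E. cl a = cl e \<and> y \<in> \<phi> a} = 0" using deg[of "cl e" y] y by simp
    ultimately show False using fin by auto
  qed
  define U where "U = {e\<in>E. x \<in> \<phi> e}"
  define comp where "comp e = away_component \<phi> x {a\<in>E. cl a = cl e} e" for e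
  have comp_cl: "comp e \<subseteq> {a\<in>E. cl a = cl e}" if "e \<in> E" for e
    unfolding comp_def by (rule away_component_subset) (simp add: that)
  have comp_refl: "e \<in> comp e" for e unfolding comp_def by (rule away_component_refl)
  have finU: "finite U" using fin by (simp add: U_def)
  have finer: "cl a = cl b" if "a \<in> U" "b \<in> U" "comp a = comp b" for a b
    using comp_refl[of a] comp_cl[of b] that by (auto simp: U_def)
  from fair_share[where f' = comp and f = cl and g = \<phi>, OF finU x finer]
  obtain S where SU: "S \<subseteq> U"
    and Scl: "\<forall>c q. card {e\<in>U. cl e = c} = \<eta> x * q \<longrightarrow> card {e\<in>S. cl e = c} = q"
    and S\<phi>: "\<forall>z q. card {e\<in>U. \<phi> e = z} = \<eta> x * q \<longrightarrow> card {e\<in>S. \<phi> e = z} = q"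
    and Scomp: "\<forall>z. card {e\<in>U. comp e = z} \<ge> 2 \<longrightarrow> (\<exists>e\<in>U - S. comp e = z)"
    by blast
  have SE: "e \<in> E" "x \<in> \<phi> e" if "e \<in> S" for e using SU that by (auto simp: U_def)
  have finS: "finite S" using SU finU by (rule finite_subset)
  define \<phi>' where "\<phi>' = move_end S x y \<phi>"
  define \<eta>' where "\<eta>' = \<eta>(x := \<eta> x - 1, y := 1)"
  have \<phi>'S: "\<phi>' e = insert y (\<phi> e - {x})" if "e \<in> S" for e using that by (simp add: \<phi>'_def move_end_def)
  have \<phi>'N: "\<phi>' e = \<phi> e" if "e \<notin> S" for e using that by (simp add: \<phi>'_def move_end_def)
  have two': "card (\<phi>' e) = 2" if e: "e \<in> E" for e
  proof (cases "e \<in> S")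
    case True
    have "finite (\<phi> e)" using two[OF e] by (intro card_ge_0_finite) simp
    then show ?thesis using \<phi>'S[OF True] new[OF e] SE[OF True] two[OF e] by simp
  qed (simp add: \<phi>'N two e)
  have S_deg: "card {e\<in>S. cl e = c} = D c (part x)" for c
  proof (rule Scl[rule_format])
    have "{e\<in>U. cl e = c} = {e\<in>E. cl e = c \<and> x \<in> \<phi> e}" by (auto simp: U_def)
    then show "card {e\<in>U. cl e = c} = \<eta> x * D c (part x)" using deg[of c x] by simp
  qed
  have S_mult: "card {e\<in>S. \<phi> e = {x, w}} = M (part x) (part w) * \<eta> w" if w: "w \<noteq> x" for w
  proof (rule S\<phi>[rule_format])
    have "{e\<in>U. \<phi> e = {x, w}} = {e\<in>E. \<phi> e = {x, w}}" by (auto simp: U_def)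
    then show "card {e\<in>U. \<phi> e = {x, w}} = \<eta> x * (M (part x) (part w) * \<eta> w)"
      using mult[of x w] w by (simp add: mult_ac)
  qed
  have deg': "card {e\<in>E. cl e = c \<and> v \<in> \<phi>' e} = D c (part v) * \<eta>' v" for c v
  proof -
    consider "v = x" | "v = y" | "v \<noteq> x" "v \<noteq> y" by blast
    then show ?thesis
    proof cases
      case 1
      have "{e\<in>E. cl e = c \<and> x \<in> \<phi>' e} = {e\<in>E. cl e = c \<and> x \<in> \<phi> e} - {e\<in>S. cl e = c}"
        using xy by (auto simp: \<phi>'_def move_end_def split: if_splits)
      also have "card \<dots> = D c (part x) * \<eta> x - D c (part x)"
        using SE finS by (subst card_Diff_subset) (auto simp: deg S_deg)
      finally show ?thesis using 1 xy by (simp add: \<eta>'_def diff_mult_distrib2)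
    next
      case 2
      have "{e\<in>E. cl e = c \<and> y \<in> \<phi>' e} = {e\<in>S. cl e = c}"
        using SE new by (auto simp: \<phi>'_def move_end_def split: if_splits)
      then show ?thesis using 2 y S_deg by (simp add: \<eta>'_def)
    next
      case 3
      have "{e\<in>E. cl e = c \<and> v \<in> \<phi>' e} = {e\<in>E. cl e = c \<and> v \<in> \<phi> e}"
        using 3 by (auto simp: \<phi>'_def move_end_def split: if_splits)
      then show ?thesis using 3 deg by (simp add: \<eta>'_def)
    qed
  qed
  have mult_x: "card {e\<in>E. \<phi>' e = {x, w}} = M (part x) (part w) * \<eta>' x * \<eta>' w" if w: "w \<noteq> x" for w
  \<comment> \<open>The pairs through \<open>x\<close> include \<open>{x, y}\<close>, whose multiplicity is \<open>0\<close> because \<open>M p p = 0\<close>.\<close>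
  proof (cases "w = y")
    case True
    have "x \<notin> \<phi>' e \<or> y \<notin> \<phi>' e" if "e \<in> E" for e
      using new[OF that] xy by (auto simp: \<phi>'_def move_end_def)
    then have none: "{e\<in>E. \<phi>' e = {x, w}} = {}" using True by blast
    show ?thesis unfolding none using True y M(2) by simp
  next
    case False
    have "{e\<in>E. \<phi>' e = {x, w}} = {e\<in>E. \<phi> e = {x, w}} - {e\<in>S. \<phi> e = {x, w}}"
      using xy False by (auto simp: \<phi>'_def move_end_def split: if_splits)
    also have "card \<dots> = M (part x) (part w) * \<eta> x * \<eta> w - M (part x) (part w) * \<eta> w"
      using SE finS w by (subst card_Diff_subset) (auto simp: mult S_mult)
    also have "\<dots> = M (part x) (part w) * (\<eta> x - 1) * \<eta> w"
      by (simp add: diff_mult_distrib diff_mult_distrib2)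
    finally show ?thesis using False w xy by (simp add: \<eta>'_def)
  qed
  have mult_y: "card {e\<in>E. \<phi>' e = {y, w}} = M (part y) (part w) * \<eta>' y * \<eta>' w"
    if w: "w \<noteq> x" "w \<noteq> y" for w
  proof -
    have "\<phi>' e = {y, w} \<longleftrightarrow> e \<in> S \<and> \<phi> e = {x, w}" if e: "e \<in> E" for e
    proof (cases "e \<in> S")
      case True
      have x\<phi>: "\<phi> e = insert x (\<phi> e - {x})" using SE[OF True] by blast
      have "\<phi>' e = {y, w} \<longleftrightarrow> \<phi> e - {x} = {w}"
        unfolding \<phi>'S[OF True] using new[OF e] w by (subst insert_ident[symmetric, of y]) auto
      also have "\<dots> \<longleftrightarrow> \<phi> e = {x, w}" using x\<phi> w(1) by blast
      finally show ?thesis using True by blast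
    next
      case False
      then show ?thesis using new[OF e] by (auto simp: \<phi>'N)
    qed
    then have "{e\<in>E. \<phi>' e = {y, w}} = {e\<in>S. \<phi> e = {x, w}}" using SE by blast
    then show ?thesis using S_mult[OF w(1)] w y by (simp add: \<eta>'_def)
  qed
  have mult': "card {e\<in>E. \<phi>' e = {u, v}} = M (part u) (part v) * \<eta>' u * \<eta>' v" if uv: "u \<noteq> v" for u v
  proof -
    have comm: "{e\<in>E. \<phi>' e = {u, v}} = {e\<in>E. \<phi>' e = {v, u}}" by (simp add: insert_commute)
    consider "u = x" | "v = x" | "u = y" "v \<noteq> x" | "v = y" "u \<noteq> x" | "u \<notin> {x, y}" "v \<notin> {x, y}"
      by blast
    then show ?thesis
    proof cases
      case 1 then show ?thesis using mult_x[of v] uv by simp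
    next
      case 2
      then have "card {e\<in>E. \<phi>' e = {u, v}} = M (part v) (part u) * \<eta>' v * \<eta>' u"
        using mult_x[of u] uv unfolding comm by simp
      then show ?thesis by (simp only: M(1)[of "part u" "part v"] mult_ac)
    next
      case 3 then show ?thesis using mult_y[of v] uv by simp
    next
      case 4
      then have "card {e\<in>E. \<phi>' e = {u, v}} = M (part v) (part u) * \<eta>' v * \<eta>' u"
        using mult_y[of u] uv unfolding comm by simp
      then show ?thesis by (simp only: M(1)[of "part u" "part v"] mult_ac)
    next
      case 5
      have "\<phi>' e = {u, v} \<longleftrightarrow> \<phi> e = {u, v}" for e
      proof (cases "e \<in> S")
        case True
        then have "y \<in> \<phi>' e" "x \<in> \<phi> e" using SE[OF True] \<phi>'S[OF True] by blast+
        moreover have "y \<notin> {u, v}" "x \<notin> {u, v}" using 5 by auto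
        ultimately show ?thesis by metis
      qed (simp add: \<phi>'N)
      then show ?thesis using 5 mult[OF uv] by (simp add: \<eta>'_def)
    qed
  qed
  have conn': "edge_connected \<phi>' {e\<in>E. cl e = c}" if c: "c \<in> C" for c
    unfolding \<phi>'_def
  proof (rule edge_connected_move_end)
    show "finite {e\<in>E. cl e = c}" using fin by simp
    show "even (card {e\<in>{e\<in>E. cl e = c}. v \<in> \<phi> e})" for v
      using even[OF c, of "part v"] deg[of c v] by simp
    show "\<exists>a\<in>away_component \<phi> x {e\<in>E. cl e = c} e. x \<in> \<phi> a \<and> a \<notin> S"
      if e: "e \<in> {e\<in>E. cl e = c}"
        and two: "card {a\<in>away_component \<phi> x {e\<in>E. cl e = c} e. x \<in> \<phi> a} \<ge> 2" for e
    proof -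
      have eq: "away_component \<phi> x {e\<in>E. cl e = c} e = comp e" using e by (simp add: comp_def)
      have same: "comp a = comp e" if "a \<in> comp e" for a
      proof -
        have "cl a = c" using comp_cl[of e] e that by auto
        then have "comp a = away_component \<phi> x {e\<in>E. cl e = c} a" by (simp add: comp_def)
        also have "\<dots> = away_component \<phi> x {e\<in>E. cl e = c} e"
          by (rule away_component_eq) (simp add: eq that)
        finally show ?thesis unfolding eq .
      qed
      have "a \<in> comp e \<and> x \<in> \<phi> a \<longleftrightarrow> a \<in> U \<and> comp a = comp e" for a
        using same[of a] comp_refl[of a] comp_cl[of e] e unfolding U_def by blast
      then have "{a\<in>comp e. x \<in> \<phi> a} = {a\<in>U. comp a = comp e}" by simp
      then have "card {a\<in>U. comp a = comp e} \<ge> 2" using two unfolding eq by simp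
      then obtain a where "a \<in> U - S" "comp a = comp e" using Scomp by blast
      then show ?thesis unfolding eq using comp_refl[of a] by (auto simp: U_def)
    qed
  qed (use two new SE conn[OF c] in auto)
  have "fair_detachment E cl C part D M \<eta>' \<phi>'"
    unfolding fair_detachment_def using two' deg' mult' conn' by blast
  then show ?thesis unfolding \<eta>'_def by blast
qed

text \<open>
  Part \<open>i\<close> is split in the order \<open>m - 1\<close>, \<open>m - 2\<close>, ..., \<open>1\<close> of second components: the vertex
  \<open>(i, 0)\<close> still carries weight \<open>k i\<close>, and the vertices \<open>(i, j)\<close> with \<open>k i \<le> j < m\<close> are the ones
  already split off.
\<close>

definition split_weight :: "nat \<Rightarrow> nat \<Rightarrow> (nat \<Rightarrow> nat) \<Rightarrow> nat \<times> nat \<Rightarrow> nat" where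
  "split_weight n m k v = (if fst v < n then if snd v = 0 then k (fst v)
     else if k (fst v) \<le> snd v \<and> snd v < m then 1 else 0 else 0)"

lemma split_all_vertices:
  assumes fin: "finite E"
    and even: "\<And>c p. c \<in> C \<Longrightarrow> even (D c p)"
    and M: "\<And>p q. M p q = M q p" "\<And>p. M p p = 0"
    and fd: "fair_detachment E cl C fst D M (split_weight n m k) \<phi>"
    and k: "\<And>i. i < n \<Longrightarrow> 1 \<le> k i \<and> k i \<le> m"
  shows "\<exists>\<phi>'. fair_detachment E cl C fst D M (\<lambda>v. if v \<in> {..<n} \<times> {..<m} then 1 else 0) \<phi>'"
  using fd k
proof (induction "\<Sum>i<n. k i" arbitrary: k \<phi> rule: less_induct)
  case less
  show ?case
  proof (cases "\<exists>i<n. k i \<ge> 2")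
    case True
    then obtain i where i: "i < n" "k i \<ge> 2" by blast
    define k' where "k' = k(i := k i - 1)"
    define w where "w = split_weight n m k"
    have ki: "k i \<le> m" using less.prems(2)[OF i(1)] by simp
    have at_x: "w (i, 0) = k i" using i by (simp add: w_def split_weight_def)
    have at_y: "w (i, k i - 1) = 0" using i by (simp add: w_def split_weight_def) linarith
    \<comment> \<open>The new vertex takes the largest second component that is not yet in use in part \<open>i\<close>.\<close>
    have "\<exists>\<phi>'. fair_detachment E cl C fst D M (w((i, 0) := w (i, 0) - 1, (i, k i - 1) := 1)) \<phi>'"
      by (rule split_vertex[OF fin even M less.prems(1)[folded w_def]]) (use i at_x at_y in auto)
    moreover have "w((i, 0) := w (i, 0) - 1, (i, k i - 1) := 1) = split_weight n m k'"
    proof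
      fix v :: "nat \<times> nat"
      obtain a b where v: "v = (a, b)" by (cases v)
      show "(w((i, 0) := w (i, 0) - 1, (i, k i - 1) := 1)) v = split_weight n m k' v"
        unfolding v using i ki by (auto simp: w_def split_weight_def k'_def)
    qed
    ultimately obtain \<phi>' where \<phi>': "fair_detachment E cl C fst D M (split_weight n m k') \<phi>'" by auto
    have "(\<Sum>j<n. k' j) < (\<Sum>j<n. k j)"
      by (rule sum_strict_mono_ex1) (use i in \<open>auto simp: k'_def\<close>)
    moreover have "1 \<le> k' j \<and> k' j \<le> m" if "j < n" for j
      using less.prems(2)[OF that] i ki by (auto simp: k'_def)
    ultimately show ?thesis using less.hyps[OF _ \<phi>'] by blast
  next
    case False
    then have "k i = 1" if "i < n" for i using less.prems(2)[OF that] that by (metis Suc_1 le_antisym not_less_eq_eq)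
    then have "split_weight n m k = (\<lambda>v. if v \<in> {..<n} \<times> {..<m} then 1 else 0)"
      using less.prems(2) by (fastforce simp: split_weight_def fun_eq_iff)
    then show ?thesis using less.prems(1) by auto
  qed
qed

section \<open>Lifting decompositions of complete multigraphs\<close>

text \<open>
  The vertices covered by a closed set of edges are closed under adjacency, so they are all vertices
  if there are any.
\<close>

lemma edge_connected_ends:
  assumes wf: "wf_multigraph H" and conn: "connected_multigraph H"
  shows "edge_connected (ends H) (edges H)"
  unfolding edge_connected_def
proof (intro allI impI)
  fix B assume B: "B \<subseteq> edges H" "B \<noteq> {}"
    and closed: "\<forall>e\<in>B. \<forall>e'\<in>edges H. ends H e \<inter> ends H e' \<noteq> {} \<longrightarrow> e' \<in> B"
  have ne: "ends H e \<noteq> {}" "ends H e \<subseteq> verts H" if "e \<in> edges H" for e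
    using wf that unfolding wf_multigraph_def by force+
  obtain e0 u where e0: "e0 \<in> B" "u \<in> ends H e0" using B ne by blast
  have reach: "v \<in> (\<Union>e\<in>B. ends H e)" if "(u, v) \<in> (adjacency H)\<^sup>*" for v
    using that
  proof (induction rule: rtrancl_induct)
    case base then show ?case using e0 by blast
  next
    case (step v w)
    then obtain e where e: "e \<in> edges H" "ends H e = {v, w}" by (auto simp: adjacency_def)
    then have "e \<in> B" using step.IH closed by blast
    then show ?case using e by blast
  qed
  have "e \<in> B" if e: "e \<in> edges H" for e
  proof -
    obtain v where v: "v \<in> ends H e" using ne[OF e] by blast
    have "u \<in> verts H" "v \<in> verts H" using e0 v ne e B by blast+
    then have "(u, v) \<in> (adjacency H)\<^sup>*" using conn unfolding connected_multigraph_def by blast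
    then show ?thesis using reach closed v e by blast
  qed
  then show "B = edges H" using B by blast
qed

text \<open>
  The edges that meet the set of vertices reachable from a vertex \<open>u\<close> form a closed set, hence are
  all edges; and every vertex lies on an edge.
\<close>

lemma connected_multigraphI:
  assumes wf: "wf_multigraph H" and ne: "verts H \<noteq> {}"
    and cover: "\<And>v. v \<in> verts H \<Longrightarrow> mg_degree H v > 0"
    and conn: "edge_connected (ends H) (edges H)"
  shows "connected_multigraph H"
  unfolding connected_multigraph_def
proof (intro conjI ballI)
  fix u v assume uv: "u \<in> verts H" "v \<in> verts H"
  have edge_at: "\<exists>e\<in>edges H. w \<in> ends H e" if "w \<in> verts H" for w
    using cover[OF that] by (auto simp: mg_degree_def card_gt_0_iff)
  define R where "R = {w. (u, w) \<in> (adjacency H)\<^sup>*}"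
  have step: "w' \<in> R" if "e \<in> edges H" "w \<in> ends H e" "w' \<in> ends H e" "w \<in> R" for e w w'
  proof (cases "w = w'")
    case False
    have "card (ends H e) = 2" using wf that by (simp add: wf_multigraph_def)
    then have "ends H e = {w, w'}" using that False by (auto simp: card_2_iff)
    then have "(w, w') \<in> adjacency H" using that by (auto simp: adjacency_def)
    then show ?thesis using that by (auto simp: R_def intro: rtrancl_into_rtrancl)
  qed (use that in simp)
  define B where "B = {e\<in>edges H. ends H e \<inter> R \<noteq> {}}"
  have "u \<in> R" by (simp add: R_def)
  have "B = edges H"
  proof (rule edge_connectedD[OF conn])
    show "B \<noteq> {}" using edge_at[OF uv(1)] \<open>u \<in> R\<close> by (auto simp: B_def)
    show "e' \<in> B" if ee: "e \<in> B" "e' \<in> edges H" "ends H e \<inter> ends H e' \<noteq> {}" for e e'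
    proof -
      obtain w w' where w: "w \<in> ends H e" "w \<in> R" "w' \<in> ends H e" "w' \<in> ends H e'"
        using ee by (auto simp: B_def)
      then have "w' \<in> R" using step[of e w w'] ee(1) by (simp add: B_def)
      then show ?thesis using w ee(2) by (auto simp: B_def)
    qed
  qed (auto simp: B_def)
  moreover obtain e where e: "e \<in> edges H" "v \<in> ends H e" using edge_at[OF uv(2)] by blast
  ultimately obtain w where "w \<in> ends H e" "w \<in> R" by (auto simp: B_def)
  then have "v \<in> R" using step e by blast
  then show "(u, v) \<in> (adjacency H)\<^sup>*" by (simp add: R_def)
qed (rule ne)

text \<open>
  A closed nonempty set of copies projects onto a closed set of edges, hence onto all of \<open>A\<close>, and it
  contains all copies of an edge with one of them, since they share their ends.
\<close>

lemma edge_connected_blow_up: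
  assumes conn: "edge_connected \<phi> A" and ne: "\<And>e. e \<in> A \<Longrightarrow> \<phi> e \<noteq> {}"
  shows "edge_connected (\<lambda>e. g ` \<phi> (fst e)) (A \<times> T)"
  unfolding edge_connected_def
proof (intro allI impI)
  fix B assume B: "B \<subseteq> A \<times> T" "B \<noteq> {}"
    and closed: "\<forall>e\<in>B. \<forall>e'\<in>A \<times> T. g ` \<phi> (fst e) \<inter> g ` \<phi> (fst e') \<noteq> {} \<longrightarrow> e' \<in> B"
  have "fst ` B = A"
  proof (rule edge_connectedD[OF conn])
    show "fst ` B \<subseteq> A" "fst ` B \<noteq> {}" using B by auto
    fix a b assume a: "a \<in> fst ` B" and b: "b \<in> A" and meet: "\<phi> a \<inter> \<phi> b \<noteq> {}"
    obtain t where t: "(a, t) \<in> B" using a by auto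
    then have "(b, t) \<in> A \<times> T" using b B by blast
    moreover have "g ` \<phi> (fst (a, t)) \<inter> g ` \<phi> (fst (b, t)) \<noteq> {}" using meet by auto
    ultimately have "(b, t) \<in> B" using closed t by blast
    then show "b \<in> fst ` B" by force
  qed
  have "e \<in> B" if e: "e \<in> A \<times> T" for e
  proof -
    have "fst e \<in> fst ` B" unfolding \<open>fst ` B = A\<close> using e by auto
    then obtain a where a: "a \<in> B" "fst a = fst e" by force
    have "g ` \<phi> (fst a) \<inter> g ` \<phi> (fst e) \<noteq> {}" using a ne[of "fst e"] e by auto
    then show ?thesis using closed a e by blast
  qed
  then show "B = A \<times> T" using B by blast
qed

lemma edge_connected_image:
  assumes conn: "edge_connected \<phi> A" and h: "\<And>e. e \<in> A \<Longrightarrow> \<psi> (h e) = \<phi> e"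
  shows "edge_connected \<psi> (h ` A)"
  unfolding edge_connected_def
proof (intro allI impI)
  fix B assume B: "B \<subseteq> h ` A" "B \<noteq> {}"
    and closed: "\<forall>e\<in>B. \<forall>e'\<in>h ` A. \<psi> e \<inter> \<psi> e' \<noteq> {} \<longrightarrow> e' \<in> B"
  have "{e\<in>A. h e \<in> B} = A"
  proof (rule edge_connectedD[OF conn])
    show "{e\<in>A. h e \<in> B} \<noteq> {}" using B by blast
    fix a b assume "a \<in> {e\<in>A. h e \<in> B}" "b \<in> A" "\<phi> a \<inter> \<phi> b \<noteq> {}"
    then show "b \<in> {e\<in>A. h e \<in> B}" using closed[rule_format, of "h a" "h b"] h[of a] h[of b] by auto
  qed auto
  then show "B = h ` A" using B by blast
qed

lemma card_filter_nonzero: "finite E \<Longrightarrow> e \<in> E \<Longrightarrow> Q e \<Longrightarrow> card {e\<in>E. Q e} \<noteq> 0"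
  by auto

lemma mg_degree_outside:
  assumes "wf_multigraph H" "v \<notin> verts H"
  shows "mg_degree H v = 0"
proof -
  have "{e\<in>edges H. v \<in> ends H e} = {}" using assms by (auto simp: wf_multigraph_def)
  then show ?thesis unfolding mg_degree_def by (simp only: card.empty)
qed

lemma mg_degree_decomposition:
  assumes wf: "wf_multigraph G" and dec: "decomposition Hs G"
  shows "mg_degree G v = (\<Sum>i<length Hs. mg_degree (Hs ! i) v)"
proof -
  have sub: "sub_multigraph (Hs ! i) G" if "i < length Hs" for i
    using dec that by (simp add: decomposition_def)
  have uniq: "\<exists>!i. i < length Hs \<and> e \<in> edges (Hs ! i)" if "e \<in> edges G" for e
    using dec that by (simp add: decomposition_def)
  have "{e\<in>edges G. v \<in> ends G e} = (\<Union>i<length Hs. {e\<in>edges (Hs ! i). v \<in> ends (Hs ! i) e})"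
    (is "?L = ?R")
  proof (intro equalityI subsetI)
    fix e assume e: "e \<in> ?L"
    then obtain i where i: "i < length Hs" "e \<in> edges (Hs ! i)" using uniq by blast
    then show "e \<in> ?R" using e sub[OF i(1)] by (auto simp: sub_multigraph_def)
  next
    fix e assume "e \<in> ?R"
    then obtain i where "i < length Hs" "e \<in> edges (Hs ! i)" "v \<in> ends (Hs ! i) e" by blast
    then show "e \<in> ?L" using sub[of i] by (auto simp: sub_multigraph_def)
  qed
  moreover have "card ?R = (\<Sum>i<length Hs. card {e\<in>edges (Hs ! i). v \<in> ends (Hs ! i) e})"
  proof (rule card_UN_disjoint)
    show "\<forall>i\<in>{..<length Hs}. finite {e\<in>edges (Hs ! i). v \<in> ends (Hs ! i) e}"
      using sub by (auto simp: sub_multigraph_def wf_multigraph_def)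
    show "\<forall>i\<in>{..<length Hs}. \<forall>j\<in>{..<length Hs}. i \<noteq> j \<longrightarrow>
      {e\<in>edges (Hs ! i). v \<in> ends (Hs ! i) e} \<inter> {e\<in>edges (Hs ! j). v \<in> ends (Hs ! j) e} = {}"
    proof (intro ballI impI)
      fix i j assume ij: "i \<in> {..<length Hs}" "j \<in> {..<length Hs}" "i \<noteq> j"
      have "edges (Hs ! i) \<inter> edges (Hs ! j) = {}"
        using uniq sub[of i] ij unfolding sub_multigraph_def by blast
      then show "{e\<in>edges (Hs ! i). v \<in> ends (Hs ! i) e} \<inter> {e\<in>edges (Hs ! j). v \<in> ends (Hs ! j) e} = {}"
        by blast
    qed
  qed simp
  ultimately show ?thesis unfolding mg_degree_def by simp
qed

text \<open>
  Numbering the parallel edges of each end pair brings an abstract edge set into the form that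
  \<open>edge_multiple\<close> gives to its edges.
\<close>

lemma edges_bij_betw_multiple:
  assumes fin: "finite E" and \<phi>: "\<phi> ` E \<subseteq> P" and mult: "\<And>p. p \<in> P \<Longrightarrow> card {e\<in>E. \<phi> e = p} = \<mu>"
  shows "\<exists>h. bij_betw h E (P \<times> {..<\<mu>}) \<and> (\<forall>e. fst (h e) = \<phi> e)"
proof -
  have "\<exists>b. bij_betw b {e\<in>E. \<phi> e = p} {..<\<mu>}" if "p \<in> P" for p
    using finite_same_card_bij[of "{e\<in>E. \<phi> e = p}" "{..<\<mu>}"] fin mult[OF that] by simp
  then obtain b where b: "\<And>p. p \<in> P \<Longrightarrow> bij_betw (b p) {e\<in>E. \<phi> e = p} {..<\<mu>}" by metis
  define h where "h e = (\<phi> e, b (\<phi> e) e)" for e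
  have "inj_on h E"
  proof (rule inj_onI)
    fix e e' assume ee: "e \<in> E" "e' \<in> E" "h e = h e'"
    then have "inj_on (b (\<phi> e)) {a\<in>E. \<phi> a = \<phi> e}" using b \<phi> bij_betw_imp_inj_on by blast
    then show "e = e'" using ee by (auto simp: h_def dest: inj_onD)
  qed
  moreover have "h ` E = P \<times> {..<\<mu>}"
  proof (intro equalityI subsetI)
    fix z assume "z \<in> h ` E"
    then obtain e where e: "e \<in> E" "z = h e" by blast
    then have "b (\<phi> e) e \<in> {..<\<mu>}" using bij_betw_apply[OF b[of "\<phi> e"], of e] \<phi> by blast
    then show "z \<in> P \<times> {..<\<mu>}" using e \<phi> by (auto simp: h_def)
  next
    fix z assume z: "z \<in> P \<times> {..<\<mu>}"
    then have "snd z \<in> b (fst z) ` {e\<in>E. \<phi> e = fst z}"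
      using bij_betw_imp_surj_on[OF b[of "fst z"]] by auto
    then obtain e where "e \<in> E" "\<phi> e = fst z" "b (fst z) e = snd z" by auto
    then show "z \<in> h ` E" by (intro image_eqI[of _ _ e]) (auto simp: h_def prod_eq_iff)
  qed
  ultimately show ?thesis by (intro exI[of _ h]) (simp add: bij_betw_def h_def)
qed

lemma ends_edge_multiple: "ends (edge_multiple \<mu> (complete_graph n)) e = fst e"
  "ends (edge_multiple \<mu> (complete_equipartite n m)) e' = fst e'"
  by (simp_all add: edge_multiple_def complete_graph_def complete_equipartite_def)

text \<open>
  The features of a piece that survive when each vertex is replaced by \<open>m\<close> vertices. Positive degrees
  are required for connectedness since an isolated vertex would become \<open>m\<close> isolated vertices.
\<close>

definition lifts_to :: "nat \<Rightarrow> ('v, 'e) multigraph \<Rightarrow> ('v \<times> nat, 'f) multigraph \<Rightarrow> bool" where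
  "lifts_to m H H' \<longleftrightarrow>
     wf_multigraph H' \<and> verts H' = verts H \<times> {..<m} \<and>
     card (edges H') = card (edges H) * m \<and>
     (\<forall>v. \<forall>j<m. mg_degree H' (v, j) = mg_degree H v) \<and>
     (connected_multigraph H \<longrightarrow>
       (\<forall>v\<in>verts H. even (mg_degree H v) \<and> mg_degree H v > 0) \<longrightarrow> connected_multigraph H')"

text \<open>
  Take every edge of the given graph \<open>m\<close> times, each copy in the class of its piece, and give vertex
  \<open>i\<close> the weight \<open>m\<close>. A piece then has degree proportional to the weights with its old degrees as
  factors, and two distinct vertices are joined by \<open>lam * m * m\<close> edges, which is \<open>lam\<close> times the
  product of their weights. Splitting down to weight \<open>1\<close> leaves exactly \<open>lam\<close> edges between any two
  vertices of different parts.
\<close>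

lemma lift_decomposition:
  fixes lam m n :: nat
  assumes m: "m > 0" and dec: "decomposition Hs (edge_multiple (lam * m) (complete_graph n))"
  shows "\<exists>Hs'. list_all2 (lifts_to m) Hs Hs' \<and>
    decomposition Hs' (edge_multiple lam (complete_equipartite n m))"
proof -
  define G where "G = edge_multiple (lam * m) (complete_graph n)"
  define G' where "G' = edge_multiple lam (complete_equipartite n m)"
  have wfG: "wf_multigraph G" unfolding G_def by (intro wf_edge_multiple wf_complete_graph)
  have endsG: "ends G e = fst e" and endsG': "ends G' e' = fst e'" for e e'
    by (simp_all add: G_def G'_def ends_edge_multiple)
  have sub: "sub_multigraph (Hs ! i) G" if "i < length Hs" for i
    using dec that by (simp add: decomposition_def G_def)
  have wfH: "wf_multigraph (Hs ! i)" and edgesH: "edges (Hs ! i) \<subseteq> edges G"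
    and vertsH: "verts (Hs ! i) \<subseteq> {..<n}"
    and endsH: "\<And>e. e \<in> edges (Hs ! i) \<Longrightarrow> ends (Hs ! i) e = fst e" if "i < length Hs" for i
    using sub[OF that] endsG unfolding sub_multigraph_def
    by (auto simp: G_def edge_multiple_def complete_graph_def)
  have uniq: "\<exists>!i. i < length Hs \<and> e \<in> edges (Hs ! i)" if "e \<in> edges G" for e
    using dec that by (simp add: decomposition_def G_def)
  define cl0 where "cl0 e = (THE i. i < length Hs \<and> e \<in> edges (Hs ! i))" for e
  have cl0: "cl0 e < length Hs" "e \<in> edges (Hs ! cl0 e)" if "e \<in> edges G" for e
    using theI'[OF uniq[OF that]] by (simp_all add: cl0_def)
  have cl0_eq: "cl0 e = i" if "i < length Hs" "e \<in> edges (Hs ! i)" for e i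
    using uniq[of e] cl0[of e] that edgesH[OF that(1)] by blast
  define E where "E = edges G \<times> {..<m}"
  define cl :: "(nat set \<times> nat) \<times> nat \<Rightarrow> nat" where "cl e = cl0 (fst e)" for e
  define \<phi>0 where "\<phi>0 e = (\<lambda>i. (i, 0::nat)) ` fst (fst e)" for e :: "(nat set \<times> nat) \<times> nat"
  define D where "D c p = (if c < length Hs then mg_degree (Hs ! c) p else 0)" for c p
  define M where "M p q = (if p < n \<and> q < n \<and> p \<noteq> q then lam else 0)" for p q
  define C where "C = {c. c < length Hs \<and> connected_multigraph (Hs ! c) \<and>
    (\<forall>v\<in>verts (Hs ! c). even (mg_degree (Hs ! c) v))}"
  have finE: "finite E" using wfG by (simp add: E_def wf_multigraph_def)
  have cls: "{e\<in>E. cl e = i} = edges (Hs ! i) \<times> {..<m}" if i: "i < length Hs" for i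
  proof (intro equalityI subsetI)
    fix e assume "e \<in> {e\<in>E. cl e = i}"
    then show "e \<in> edges (Hs ! i) \<times> {..<m}" using cl0[of "fst e"] by (auto simp: E_def cl_def)
  next
    fix e assume "e \<in> edges (Hs ! i) \<times> {..<m}"
    then show "e \<in> {e\<in>E. cl e = i}" using cl0_eq[OF i, of "fst e"] edgesH[OF i]
      by (auto simp: E_def cl_def)
  qed
  have cls_none: "{e\<in>E. cl e = i} = {}" if "\<not> i < length Hs" for i
    using cl0 that by (auto simp: E_def cl_def)
  have even: "even (D c p)" if c: "c \<in> C" for c p
  proof (cases "p \<in> verts (Hs ! c)")
    case False
    then show ?thesis using mg_degree_outside[OF wfH] c by (simp add: C_def D_def)
  qed (use c in \<open>simp add: C_def D_def\<close>)
  have weight: "split_weight n m (\<lambda>_. m) v = (if fst v < n \<and> snd v = 0 then m else 0)" for v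
    by (simp add: split_weight_def)
  have D_out: "D c p = 0" if "\<not> p < n" for c p
    using mg_degree_outside[OF wfH, of c p] vertsH[of c] that by (auto simp: D_def)
  have fd0: "fair_detachment E cl C fst D M (split_weight n m (\<lambda>_. m)) \<phi>0"
    unfolding fair_detachment_def
  proof (intro conjI ballI allI impI)
    fix e assume "e \<in> E"
    then have "card (fst (fst e)) = 2"
      using wfG endsG[of "fst e"] by (auto simp: E_def wf_multigraph_def)
    then show "card (\<phi>0 e) = 2" by (simp add: \<phi>0_def card_image inj_on_def)
  next
    fix c and v :: "nat \<times> nat"
    show "card {e\<in>E. cl e = c \<and> v \<in> \<phi>0 e} = D c (fst v) * split_weight n m (\<lambda>_. m) v"
    proof (cases "c < length Hs \<and> snd v = 0")
      case True
      have "{e\<in>E. cl e = c \<and> v \<in> \<phi>0 e} = {e\<in>{e\<in>E. cl e = c}. fst v \<in> fst (fst e)}"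
        using True by (auto simp: \<phi>0_def image_iff prod_eq_iff)
      also have "\<dots> = {e\<in>edges (Hs ! c). fst v \<in> ends (Hs ! c) e} \<times> {..<m}"
        using True endsH[of c] by (auto simp: cls)
      finally have "card {e\<in>E. cl e = c \<and> v \<in> \<phi>0 e} = D c (fst v) * m"
        using True by (simp add: D_def mg_degree_def card_cartesian_product)
      then show ?thesis using D_out[of "fst v" c] True by (simp add: weight)
    next
      case False
      then have "{e\<in>E. cl e = c \<and> v \<in> \<phi>0 e} = {}"
        using cls_none[of c] by (auto simp: \<phi>0_def)
      then have "card {e\<in>E. cl e = c \<and> v \<in> \<phi>0 e} = 0" by (simp only: card.empty)
      then show ?thesis using False by (auto simp: weight D_def)
    qed
  next
    fix u v :: "nat \<times> nat" assume uv: "u \<noteq> v"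
    show "card {e\<in>E. \<phi>0 e = {u, v}} =
        M (fst u) (fst v) * split_weight n m (\<lambda>_. m) u * split_weight n m (\<lambda>_. m) v"
    proof (cases "snd u = 0 \<and> snd v = 0 \<and> fst u < n \<and> fst v < n")
      case True
      have inj: "inj (\<lambda>i::nat. (i, 0::nat))" by (simp add: inj_def)
      have img: "(\<lambda>i. (i, 0)) ` {fst u, fst v} = {u, v}" using True by (cases u; cases v) simp
      have "\<phi>0 e = {u, v} \<longleftrightarrow> fst (fst e) = {fst u, fst v}" for e
        unfolding \<phi>0_def img[symmetric] by (rule inj_image_eq_iff[OF inj])
      moreover have ne: "fst u \<noteq> fst v" using uv True by (simp add: prod_eq_iff)
      ultimately have "{e\<in>E. \<phi>0 e = {u, v}} = ({{fst u, fst v}} \<times> {..<lam * m}) \<times> {..<m}"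
        using True by (auto simp: E_def G_def edge_multiple_def complete_graph_def)
      then show ?thesis using True ne by (simp add: weight M_def card_cartesian_product)
    next
      case False
      have "u \<notin> \<phi>0 e \<or> v \<notin> \<phi>0 e" if "e \<in> E" for e
      proof -
        have "fst (fst e) \<subseteq> {..<n}" using that wfG endsG[of "fst e"]
          by (auto simp: E_def wf_multigraph_def G_def edge_multiple_def complete_graph_def)
        then show ?thesis using False by (auto simp: \<phi>0_def)
      qed
      then have "{e\<in>E. \<phi>0 e = {u, v}} = {}" by blast
      then have "card {e\<in>E. \<phi>0 e = {u, v}} = 0" by (simp only: card.empty)
      then show ?thesis using False by (auto simp: weight)
    qed
  next
    fix c assume "c \<in> C"
    then have c: "c < length Hs" "connected_multigraph (Hs ! c)" by (auto simp: C_def)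
    have nonempty: "ends (Hs ! c) e \<noteq> {}" if "e \<in> edges (Hs ! c)" for e
      using wfH[OF c(1)] that by (force simp: wf_multigraph_def)
    have "edge_connected (\<lambda>e. (\<lambda>i. (i, 0)) ` ends (Hs ! c) (fst e)) (edges (Hs ! c) \<times> {..<m})"
      using edge_connected_blow_up[OF edge_connected_ends[OF wfH[OF c(1)] c(2)] nonempty] by simp
    from edge_connected_image[OF this, of \<phi>0 "\<lambda>e. e"]
    show "edge_connected \<phi>0 {e\<in>E. cl e = c}"
      using endsH[OF c(1)] by (auto simp: cls[OF c(1)] \<phi>0_def)
  qed
  have "\<exists>\<phi>. fair_detachment E cl C fst D M (\<lambda>v. if v \<in> {..<n} \<times> {..<m} then 1 else 0) \<phi>"
    by (rule split_all_vertices[OF finE even _ _ fd0]) (use m in \<open>auto simp: M_def\<close>)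
  then obtain \<phi> where
    fd: "fair_detachment E cl C fst D M (\<lambda>v. if v \<in> {..<n} \<times> {..<m} then 1 else 0) \<phi>" by blast
  have two: "\<And>e. e \<in> E \<Longrightarrow> card (\<phi> e) = 2"
    and deg: "\<And>c v. card {e\<in>E. cl e = c \<and> v \<in> \<phi> e} =
      D c (fst v) * (if v \<in> {..<n} \<times> {..<m} then 1 else 0)"
    and mult: "\<And>u v. u \<noteq> v \<Longrightarrow> card {e\<in>E. \<phi> e = {u, v}} = M (fst u) (fst v) *
      (if u \<in> {..<n} \<times> {..<m} then 1 else 0) * (if v \<in> {..<n} \<times> {..<m} then 1 else 0)"
    and conn: "\<And>c. c \<in> C \<Longrightarrow> edge_connected \<phi> {e\<in>E. cl e = c}"
    using fd unfolding fair_detachment_def by blast+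
  define P where "P = edges (complete_equipartite n m)"
  have P: "P = {{u, v} | u v. u \<in> {..<n} \<times> {..<m} \<and> v \<in> {..<n} \<times> {..<m} \<and> fst u \<noteq> fst v}"
    by (simp add: P_def complete_equipartite_def)
  have \<phi>P: "\<phi> ` E \<subseteq> P"
  proof
    fix p assume "p \<in> \<phi> ` E"
    then obtain e where e: "e \<in> E" "p = \<phi> e" by blast
    obtain u v where uv: "\<phi> e = {u, v}" "u \<noteq> v" using two[OF e(1)] by (auto simp: card_2_iff)
    have "card {e\<in>E. \<phi> e = {u, v}} \<noteq> 0"
      by (rule card_filter_nonzero[OF finE e(1)]) (rule uv(1))
    then have "u \<in> {..<n} \<times> {..<m}" "v \<in> {..<n} \<times> {..<m}" "fst u \<noteq> fst v"
      unfolding mult[OF uv(2)] by (auto simp: M_def split: if_splits)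
    then show "p \<in> P" unfolding P e(2) uv(1) by blast
  qed
  have multP: "card {e\<in>E. \<phi> e = p} = lam" if p: "p \<in> P" for p
  proof -
    obtain u v where "p = {u, v}" "u \<in> {..<n} \<times> {..<m}" "v \<in> {..<n} \<times> {..<m}" "fst u \<noteq> fst v"
      using p unfolding P by blast
    moreover from this have "u \<noteq> v" by blast
    ultimately show ?thesis using mult[of u v] by (auto simp: M_def)
  qed
  obtain h where h: "bij_betw h E (P \<times> {..<lam})" and fst_h: "\<And>e. fst (h e) = \<phi> e"
    using edges_bij_betw_multiple[OF finE \<phi>P multP] by blast
  have inj: "inj_on h E" using h by (rule bij_betw_imp_inj_on)
  have edgesG': "edges G' = h ` E"
    using bij_betw_imp_surj_on[OF h] by (simp add: G'_def edge_multiple_def P_def)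
  define L where "L i = \<lparr>verts = verts (Hs ! i) \<times> {..<m}, edges = h ` {e\<in>E. cl e = i}, ends = ends G'\<rparr>" for i
  have degL: "mg_degree (L i) (v, j) = mg_degree (Hs ! i) v" if i: "i < length Hs" and j: "j < m" for i v j
  proof -
    have "{e\<in>edges (L i). (v, j) \<in> ends (L i) e} = h ` {e\<in>E. cl e = i \<and> (v, j) \<in> \<phi> e}"
      by (auto simp: L_def endsG' fst_h)
    then have "mg_degree (L i) (v, j) = card {e\<in>E. cl e = i \<and> (v, j) \<in> \<phi> e}"
      unfolding mg_degree_def using inj by (simp add: card_image inj_on_subset)
    also have "\<dots> = D i v" using deg[of i "(v, j)"] D_out[of v i] j by simp
    finally show ?thesis using i by (simp add: D_def)
  qed
  have vertsL: "\<phi> e \<subseteq> verts (Hs ! i) \<times> {..<m}" if i: "i < length Hs" and e: "e \<in> E" "cl e = i" for i e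
  proof
    fix v assume v: "v \<in> \<phi> e"
    have "card {e\<in>E. cl e = i \<and> v \<in> \<phi> e} \<noteq> 0"
      by (rule card_filter_nonzero[OF finE e(1)]) (use e v in simp)
    then have "v \<in> {..<n} \<times> {..<m}" "mg_degree (Hs ! i) (fst v) \<noteq> 0"
      unfolding deg using i by (auto simp: D_def split: if_splits)
    moreover from this have "fst v \<in> verts (Hs ! i)" using mg_degree_outside[OF wfH[OF i], of "fst v"] by metis
    ultimately show "v \<in> verts (Hs ! i) \<times> {..<m}" by (cases v) simp
  qed
  have subL: "sub_multigraph (L i) G'" if i: "i < length Hs" for i
    unfolding sub_multigraph_def
  proof (intro conjI)
    have "finite (verts (Hs ! i))" using wfH[OF i] by (simp add: wf_multigraph_def)
    then show "wf_multigraph (L i)"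
      using finE vertsL[OF i] two by (auto simp: wf_multigraph_def L_def endsG' fst_h)
    show "verts (L i) \<subseteq> verts G'"
      using vertsH[OF i] by (auto simp: L_def G'_def edge_multiple_def complete_equipartite_def)
  qed (auto simp: L_def edgesG')
  have connL: "connected_multigraph (L i)"
    if i: "i < length Hs" and c: "connected_multigraph (Hs ! i)"
      and d: "\<forall>v\<in>verts (Hs ! i). even (mg_degree (Hs ! i) v) \<and> mg_degree (Hs ! i) v > 0" for i
  proof (rule connected_multigraphI)
    show "wf_multigraph (L i)" using subL[OF i] by (simp add: sub_multigraph_def)
    show "verts (L i) \<noteq> {}" using c m by (auto simp: L_def connected_multigraph_def)
    show "mg_degree (L i) v > 0" if "v \<in> verts (L i)" for v
      using that d degL[OF i, of "snd v" "fst v"] by (auto simp: L_def)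
    have "i \<in> C" using i c d by (simp add: C_def)
    from edge_connected_image[OF conn[OF this], of "ends G'" h]
    show "edge_connected (ends (L i)) (edges (L i))" by (simp add: L_def endsG' fst_h)
  qed
  have decL: "decomposition (map L [0..<length Hs]) G'"
    unfolding decomposition_def
  proof (intro conjI ballI)
    show "sub_multigraph H G'" if "H \<in> set (map L [0..<length Hs])" for H
      using that subL by auto
    fix e' assume "e' \<in> edges G'"
    then obtain e where e: "e \<in> E" "e' = h e" by (auto simp: edgesG')
    have "e' \<in> edges (L i) \<longleftrightarrow> cl e = i" for i
      using e inj by (auto simp: L_def dest: inj_onD)
    moreover have "cl e < length Hs" using e cl0 by (auto simp: E_def cl_def)
    ultimately show "\<exists>!i. i < length (map L [0..<length Hs]) \<and> e' \<in> edges (map L [0..<length Hs] ! i)"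
      by (intro ex1I[of _ "cl e"]) auto
  qed
  have cardL: "card (edges (L i)) = card (edges (Hs ! i)) * m" if i: "i < length Hs" for i
  proof -
    have "card (edges (L i)) = card {e\<in>E. cl e = i}"
      unfolding L_def using inj by (simp add: card_image inj_on_subset)
    then show ?thesis by (simp add: cls[OF i] card_cartesian_product)
  qed
  have "list_all2 (lifts_to m) Hs (map L [0..<length Hs])"
    unfolding list_all2_conv_all_nth lifts_to_def
    using subL by (auto simp: degL cardL connL sub_multigraph_def)
      (auto simp: L_def)
  then show ?thesis using decL by (auto simp: G'_def)
qed

lemma cycle_lifts:
  assumes cyc: "cycle_of_length c H" and m: "m > 0" and lift: "lifts_to m H H'"
  shows "cycle_of_length (c * m) H'"
proof -
  have "regular_multigraph 2 H" "connected_multigraph H" "c \<ge> 2" "card (edges H) = c"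
    using cyc by (auto simp: cycle_of_length_def)
  moreover from this have "connected_multigraph H'"
    using lift by (auto simp: lifts_to_def regular_multigraph_def)
  moreover have "c * m \<ge> 2 * 1" using \<open>c \<ge> 2\<close> m by (intro mult_le_mono) auto
  ultimately show ?thesis
    using lift by (auto simp: lifts_to_def cycle_of_length_def regular_multigraph_def)
qed

lemma cycles_lift:
  assumes "list_all2 cycle_of_length cs Hs" "list_all2 (lifts_to m) Hs Hs'" "m > 0"
  shows "list_all2 cycle_of_length (map (\<lambda>c. c * m) cs) Hs'"
  using assms cycle_lifts[OF _ assms(3)] unfolding list_all2_conv_all_nth
  by (metis length_map nth_map)

lemma one_factor_lifts:
  assumes F: "one_factor F G" and lift: "lifts_to m F F'" and sub: "sub_multigraph F' G'"
    and verts: "verts G' = verts G \<times> {..<m}"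
  shows "one_factor F' G'"
  using assms by (auto simp: one_factor_def lifts_to_def regular_multigraph_def)

lemma degree_lifts:
  assumes wf: "wf_multigraph G" "wf_multigraph G'"
    and dec: "decomposition Hs G" "decomposition Hs' G'"
    and lift: "list_all2 (lifts_to m) Hs Hs'" and j: "j < m"
  shows "mg_degree G' (v, j) = mg_degree G v"
proof -
  have "mg_degree (Hs' ! i) (v, j) = mg_degree (Hs ! i) v" if "i < length Hs" for i
    using list_all2_nthD[OF lift that] j by (simp add: lifts_to_def)
  then show ?thesis
    using mg_degree_decomposition[OF wf(1) dec(1)] mg_degree_decomposition[OF wf(2) dec(2)]
      list_all2_lengthD[OF lift] by simp
qed

theorem theorem1p4:
  fixes lam m n k :: nat and cs :: "nat list"
  assumes "lam > 0" and "m > 0" and "n > 0" and "k > 0"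
    and "length cs = k" and "\<forall>c\<in>set cs. c > 0"
    and "cycle_decomposition cs (edge_multiple (lam * m) (complete_graph n))"
  shows "cycle_decomposition (map (\<lambda>c. c * m) cs) (edge_multiple lam (complete_equipartite n m))"
proof -
  let ?G = "edge_multiple (lam * m) (complete_graph n)"
  let ?G' = "edge_multiple lam (complete_equipartite n m)"
  note m = \<open>m > 0\<close>
  have wf: "wf_multigraph ?G" "wf_multigraph ?G'"
    by (intro wf_edge_multiple wf_complete_graph wf_complete_equipartite)+
  have verts: "verts ?G' = verts ?G \<times> {..<m}"
    by (simp add: edge_multiple_def complete_graph_def complete_equipartite_def)
  from assms(7) consider
    (even_degrees) Hs where "\<forall>v\<in>verts ?G. even (mg_degree ?G v)"
      "list_all2 cycle_of_length cs Hs" "decomposition Hs ?G" |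
    (odd_degrees) Hs F where "\<forall>v\<in>verts ?G. odd (mg_degree ?G v)"
      "list_all2 cycle_of_length cs Hs" "one_factor F ?G" "decomposition (F # Hs) ?G"
    unfolding cycle_decomposition_def by blast
  then show ?thesis
  proof cases
    case even_degrees
    obtain Hs' where lift: "list_all2 (lifts_to m) Hs Hs'" and dec: "decomposition Hs' ?G'"
      using lift_decomposition[OF m even_degrees(3)] by blast
    have "\<forall>v\<in>verts ?G'. even (mg_degree ?G' v)"
      using degree_lifts[OF wf even_degrees(3) dec lift] even_degrees(1) unfolding verts by auto
    then show ?thesis unfolding cycle_decomposition_def
      using dec cycles_lift[OF even_degrees(2) lift m] by blast
  next
    case odd_degrees
    obtain Ks where lift: "list_all2 (lifts_to m) (F # Hs) Ks" and dec: "decomposition Ks ?G'"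
      using lift_decomposition[OF m odd_degrees(4)] by blast
    then obtain F' Hs' where Ks: "Ks = F' # Hs'" "lifts_to m F F'" "list_all2 (lifts_to m) Hs Hs'"
      by (auto simp: list_all2_Cons1)
    have "sub_multigraph F' ?G'" using dec Ks(1) by (simp add: decomposition_def)
    then have "one_factor F' ?G'" by (rule one_factor_lifts[OF odd_degrees(3) Ks(2) _ verts])
    moreover have "\<forall>v\<in>verts ?G'. odd (mg_degree ?G' v)"
      using degree_lifts[OF wf odd_degrees(4) dec lift] odd_degrees(1) unfolding verts by auto
    ultimately show ?thesis unfolding cycle_decomposition_def
      using dec Ks(1) cycles_lift[OF odd_degrees(2) Ks(3) m] by blast
  qed
qed

end
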